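(* Let $\lambda$ be a partition with at most $n$ parts. (i) If $\eta\in UGC_\lambda(n)$, then $\pi:=\Pi_\lambda[\Delta_\lambda(\eta)]\in S_n^{\lambda\text{-}312}$ and $s_\lambda(\eta;x)\equiv d_\lambda(\pi;x)$, i.e. $\mathcal{S}_\lambda(\eta)=\mathcal{D}_\lambda(\pi)$. (ii) If $\pi\in S_n^{\lambda\text{-}312}$, then $\gamma:=\Psi_\lambda(\pi)\in UG_\lambda(n)$ and $d_\lambda(\pi;x)\equiv s_\lambda(\gamma;x)$, i.e. $\mathcal{D}_\lambda(\pi)=\mathcal{S}_\lambda(\gamma)$. (iii) For every $\varphi\in UF_\lambda(n)$ there is exactly one $\pi\in S_n^\lambda$ with $s_\lambda(\varphi;x)\equiv d_\lambda(\pi;x)$; and for every $\pi\in S_n^{\lambda\text{-}312}$ the Demazure polynomial $d_\lambda(\pi;x)$ is identical to a (uniquely determined) flag Schur polynomial $s_\lambda(\varphi;x)$, $\varphi\in UF_\lambda(n)$.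
   Context: Fix $n\ge1$; $[m]=\{1,\dots,m\}$, $(a,b]=\{a+1,\dots,b\}$; $\mathrm{rank}^d(Q)$ = $d$-th largest element of a finite $Q\subset\mathbb{Z}$. Partition $\lambda=(\lambda_1\ge\cdots\ge\lambda_n\ge0)$; boxes $(j,i)$, $1\le j\le\lambda_1$, $1\le i\le\zeta_j=\#\{i:\lambda_i\ge j\}$. $R_\lambda=\{q_1<\cdots<q_r\}\subseteq[n-1]$ = column lengths less than $n$; $q_0=0$, $q_{r+1}=n$, $p_h=q_h-q_{h-1}$, carrels $(q_{h-1},q_h]$. $\lambda$-tuples: $\nu\in[n]^n$; $U_\lambda(n)$ upper ones ($\nu_i\ge i$); $UF_\lambda(n)$ upper weakly increasing ones; $UI_\lambda(n)$ upper ones strictly increasing on each carrel. $S_n^\lambda$: permutations of $[n]$ strictly increasing on each carrel; $\pi$ is $\lambda$-312-containing if there exist $h\in[r-1]$, $a\le q_h<b\le q_{h+1}<c\le n$ with $\pi_b<\pi_c<\pi_a$, else $\lambda$-312-avoiding ($S_n^{\lambda\text{-}312}$). $\Psi_\lambda(\pi)_i=\mathrm{rank}^{q_h-i+1}(\{\pi_1,\dots,\pi_{q_h}\})$ for $i\in(q_{h-1},q_h]$. Gapless: $\gamma\in UI_\lambda(n)$ such that for each $h\in[r]$ with $\gamma_{q_h}>\gamma_{q_h+1}$, $s=\gamma_{q_h}-\gamma_{q_h+1}+1\le p_{h+1}$ and $\gamma_{q_h+t}=\gamma_{q_h}-s+t$, $t=1,\dots,s$; set $UG_\lambda(n)$.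 $\Pi_\lambda(\gamma)=\pi$: $\pi_i=\gamma_i$ on $(0,q_1]$; for $h\in[r]$, $s=\gamma_{q_h}-\gamma_{q_h+1}+1$ if $\gamma_{q_h}>\gamma_{q_h+1}$ else $0$; $\pi_i=\gamma_i$ on $(q_h+s,q_{h+1}]$, $\pi_i=\mathrm{rank}^{q_h+s-i+1}([\gamma_{q_h}]\setminus\{\pi_1,\dots,\pi_{q_h}\})$ on $(q_h,q_h+s]$. Critical indices of $\upsilon\in U_\lambda(n)$: in carrel $h$, $x_1=q_h$, and while possible $x_u$ = largest $x\in(q_{h-1},x_{u-1})$ with $\upsilon_{x_{u-1}}-\upsilon_x>x_{u-1}-x$. Core $\Delta_\lambda(\upsilon)$: equals $\upsilon_x$ at critical $x$ and $\upsilon_x-(x-i)$ at non-critical $i$, $x$ the smallest critical index $>i$. $UGC_\lambda(n)=\{\upsilon:\Delta_\lambda(\upsilon)\in UG_\lambda(n)\}$. Tableaux: $T_j(i)\in[n]$ strictly increasing down columns, weakly along rows; $\mathcal{T}_\lambda$. $\Theta(T)$ content, $x^{\Theta(T)}=\prod x_i^{\theta_i}$. $\mathcal{S}_\lambda(\beta)=\{T:T_j(i)\le\beta_i\ \forall(j,i)\}$, $s_\lambda(\beta;x)=\sum_{\mathcal{S}_\lambda(\beta)}x^{\Theta(T)}$ (flag Schur polynomial when $\beta\in UF_\lambda(n)$). $\lambda$-key $Y_\lambda(\pi)$: columns left to right $\lambda_n$ copies of the column $[n]$, then for $h=r,\dots,1$, $\lambda_{q_h}-\lambda_{q_{h+1}}$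 copies of the column with entries $\{\pi_1,\dots,\pi_{q_h}\}$ increasing downward. Scanning tableau $S(T)$: EWIS of $x_1,x_2,\dots$ is $x_{i_1},\dots$, $i_1=1$, $i_u$ smallest index $>i_{u-1}$ with $x_{i_u}\ge x_{i_{u-1}}$; column $j$ of $S(T)$: with columns $j,\dots,\lambda_1$ unmarked, repeat $\zeta_j$ times: read left to right the values of the lowest unmarked boxes of columns still having unmarked boxes, take the EWIS, mark its boxes, put its last value in the lowest empty box of column $j$. $\mathcal{D}_\lambda(\pi)=\{T:S(T)\le Y_\lambda(\pi)\}$, $d_\lambda(\pi;x)=\sum_{\mathcal{D}_\lambda(\pi)}x^{\Theta(T)}$. Two such sums are identical as generating functions ($\equiv$) if they are over the same shape and their tableau sets coincide.
   Formalization: In the definition of Π_λ the number s equals γ_{q_h}−γ_{q_h+1}+1 when γ_{q_h} ≥ γ_{q_h+1} (not only >); with > the map repeats a value at equality, e.g. n=2, λ=(1,0), γ=(2,2), and is not a permutation. *)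

theory Defs
  imports
    "HOL-Library.FuncSet"
    "HOL-Library.Poly_Mapping"
    "HOL-Combinatorics.Permutations"
begin

text \<open>
  Conventions: all indices start at 1.  A partition is a function of which only the values at
  \<open>1, \<dots>, n\<close> are used; \<open>n\<close>-tuples and tableaux are extensional functions.
\<close>

definition is_partition :: "nat \<Rightarrow> (nat \<Rightarrow> nat) \<Rightarrow> bool" where
  "is_partition n lam \<longleftrightarrow> (\<forall>i\<in>{1..n}. \<forall>k\<in>{1..n}. i \<le> k \<longrightarrow> lam k \<le> lam i)"

definition col_length :: "nat \<Rightarrow> (nat \<Rightarrow> nat) \<Rightarrow> nat \<Rightarrow> nat" where
  "col_length n lam j = card {i \<in> {1..n}. lam i \<ge> j}"

text \<open>A box \<open>(j, i)\<close> lies in column \<open>j\<close> and row \<open>i\<close>; lower boxes have larger \<open>i\<close>.\<close>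

definition boxes :: "nat \<Rightarrow> (nat \<Rightarrow> nat) \<Rightarrow> (nat \<times> nat) set" where
  "boxes n lam = (SIGMA j:{1..lam 1}. {1..col_length n lam j})"

definition R_set :: "nat \<Rightarrow> (nat \<Rightarrow> nat) \<Rightarrow> nat set" where
  "R_set n lam = {c \<in> col_length n lam ` {1..lam 1}. c < n}"

definition r_num :: "nat \<Rightarrow> (nat \<Rightarrow> nat) \<Rightarrow> nat" where
  "r_num n lam = card (R_set n lam)"

definition qpos :: "nat \<Rightarrow> (nat \<Rightarrow> nat) \<Rightarrow> nat \<Rightarrow> nat" where
  "qpos n lam h = (0 # sorted_list_of_set (R_set n lam) @ [n]) ! h"

definition carrel :: "nat \<Rightarrow> (nat \<Rightarrow> nat) \<Rightarrow> nat \<Rightarrow> nat set" where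
  "carrel n lam h = {qpos n lam (h - 1) <.. qpos n lam h}"

definition carrel_index :: "nat \<Rightarrow> (nat \<Rightarrow> nat) \<Rightarrow> nat \<Rightarrow> nat" where
  "carrel_index n lam i = (THE h. h \<in> {1..r_num n lam + 1} \<and> i \<in> carrel n lam h)"

text \<open>The \<open>d\<close>-th largest element, \<open>d \<ge> 1\<close>.\<close>

definition rank_desc :: "nat \<Rightarrow> nat set \<Rightarrow> nat" where
  "rank_desc d Q = rev (sorted_list_of_set Q) ! (d - 1)"

definition carrel_increasing :: "nat \<Rightarrow> (nat \<Rightarrow> nat) \<Rightarrow> (nat \<Rightarrow> nat) \<Rightarrow> bool" where
  "carrel_increasing n lam \<nu> \<longleftrightarrow>
    (\<forall>h\<in>{1..r_num n lam + 1}. strict_mono_on (carrel n lam h) \<nu>)"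

definition U_tuples :: "nat \<Rightarrow> (nat \<Rightarrow> nat) set" where
  "U_tuples n = {\<nu> \<in> {1..n} \<rightarrow>\<^sub>E {1..n}. \<forall>i\<in>{1..n}. i \<le> \<nu> i}"

definition UF_tuples :: "nat \<Rightarrow> (nat \<Rightarrow> nat) set" where
  "UF_tuples n = {\<nu> \<in> U_tuples n. mono_on {1..n} \<nu>}"

definition UI_tuples :: "nat \<Rightarrow> (nat \<Rightarrow> nat) \<Rightarrow> (nat \<Rightarrow> nat) set" where
  "UI_tuples n lam = {\<nu> \<in> U_tuples n. carrel_increasing n lam \<nu>}"

definition UG_tuples :: "nat \<Rightarrow> (nat \<Rightarrow> nat) \<Rightarrow> (nat \<Rightarrow> nat) set" where
  "UG_tuples n lam = {\<gamma> \<in> UI_tuples n lam.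
    \<forall>h\<in>{1..r_num n lam}. \<gamma> (qpos n lam h) > \<gamma> (qpos n lam h + 1) \<longrightarrow>
      (let s = \<gamma> (qpos n lam h) - \<gamma> (qpos n lam h + 1) + 1 in
        s \<le> qpos n lam (h + 1) - qpos n lam h \<and>
        (\<forall>t\<in>{1..s}. \<gamma> (qpos n lam h + t) = \<gamma> (qpos n lam h) - s + t))}"

definition S_perms :: "nat \<Rightarrow> (nat \<Rightarrow> nat) \<Rightarrow> (nat \<Rightarrow> nat) set" where
  "S_perms n lam = {\<pi>. \<pi> permutes {1..n} \<and> carrel_increasing n lam \<pi>}"

definition contains_312 :: "nat \<Rightarrow> (nat \<Rightarrow> nat) \<Rightarrow> (nat \<Rightarrow> nat) \<Rightarrow> bool" where
  "contains_312 n lam \<pi> \<longleftrightarrow>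
    (\<exists>h\<in>{1..r_num n lam - 1}. \<exists>a b c.
      1 \<le> a \<and> a \<le> qpos n lam h \<and> qpos n lam h < b \<and> b \<le> qpos n lam (h + 1) \<and>
      qpos n lam (h + 1) < c \<and> c \<le> n \<and> \<pi> b < \<pi> c \<and> \<pi> c < \<pi> a)"

definition S312_perms :: "nat \<Rightarrow> (nat \<Rightarrow> nat) \<Rightarrow> (nat \<Rightarrow> nat) set" where
  "S312_perms n lam = {\<pi> \<in> S_perms n lam. \<not> contains_312 n lam \<pi>}"

definition Psi :: "nat \<Rightarrow> (nat \<Rightarrow> nat) \<Rightarrow> (nat \<Rightarrow> nat) \<Rightarrow> nat \<Rightarrow> nat" where
  "Psi n lam \<pi> = (\<lambda>i\<in>{1..n}.
    let h = carrel_index n lam i in rank_desc (qpos n lam h - i + 1) (\<pi> ` {1..qpos n lam h}))"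

text \<open>
  The case distinction is on \<open>\<ge>\<close>, not \<open>>\<close>: when the two entries are equal, \<open>s = 1\<close>.
  With \<open>>\<close> the value would be repeated and the map below would not produce permutations
  (\<open>n = 2\<close>, \<open>\<lambda> = (1, 0)\<close>, \<open>\<gamma> = (2, 2)\<close>).
\<close>

definition overlap :: "nat \<Rightarrow> (nat \<Rightarrow> nat) \<Rightarrow> (nat \<Rightarrow> nat) \<Rightarrow> nat \<Rightarrow> nat" where
  "overlap n lam \<gamma> h =
    (if \<gamma> (qpos n lam h) \<ge> \<gamma> (qpos n lam h + 1)
     then \<gamma> (qpos n lam h) - \<gamma> (qpos n lam h + 1) + 1 else 0)"

text \<open>\<open>Pi_stage n lam \<gamma> h\<close> is the final permutation on the carrels \<open>1, \<dots>, h + 1\<close>.\<close>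

primrec Pi_stage :: "nat \<Rightarrow> (nat \<Rightarrow> nat) \<Rightarrow> (nat \<Rightarrow> nat) \<Rightarrow> nat \<Rightarrow> nat \<Rightarrow> nat" where
  "Pi_stage n lam \<gamma> 0 = \<gamma>"
| "Pi_stage n lam \<gamma> (Suc h) =
    (let \<rho> = Pi_stage n lam \<gamma> h; qh = qpos n lam (Suc h); s = overlap n lam \<gamma> (Suc h) in
      (\<lambda>i. if i \<le> qh then \<rho> i
           else if i \<le> qh + s then rank_desc (qh + s - i + 1) ({1..\<gamma> qh} - \<rho> ` {1..qh})
           else \<gamma> i))"

definition Pi_map :: "nat \<Rightarrow> (nat \<Rightarrow> nat) \<Rightarrow> (nat \<Rightarrow> nat) \<Rightarrow> nat \<Rightarrow> nat" where
  "Pi_map n lam \<gamma> i = (if i \<in> {1..n} then Pi_stage n lam \<gamma> (r_num n lam) i else i)"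

definition critical_candidates ::
    "nat \<Rightarrow> (nat \<Rightarrow> nat) \<Rightarrow> (nat \<Rightarrow> nat) \<Rightarrow> nat \<Rightarrow> nat \<Rightarrow> nat set" where
  "critical_candidates n lam \<upsilon> h x =
    {y. qpos n lam (h - 1) < y \<and> y < x \<and> int (\<upsilon> x) - int (\<upsilon> y) > int x - int y}"

inductive_set carrel_critical ::
    "nat \<Rightarrow> (nat \<Rightarrow> nat) \<Rightarrow> (nat \<Rightarrow> nat) \<Rightarrow> nat \<Rightarrow> nat set"
  for n :: nat and lam :: "nat \<Rightarrow> nat" and \<upsilon> :: "nat \<Rightarrow> nat" and h :: nat where
  carrel_end: "qpos n lam h \<in> carrel_critical n lam \<upsilon> h"
| next_critical: "\<lbrakk>x \<in> carrel_critical n lam \<upsilon> h; critical_candidates n lam \<upsilon> h x \<noteq> {}\<rbrakk>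
    \<Longrightarrow> Max (critical_candidates n lam \<upsilon> h x) \<in> carrel_critical n lam \<upsilon> h"

definition critical :: "nat \<Rightarrow> (nat \<Rightarrow> nat) \<Rightarrow> (nat \<Rightarrow> nat) \<Rightarrow> nat set" where
  "critical n lam \<upsilon> = (\<Union>h\<in>{1..r_num n lam + 1}. carrel_critical n lam \<upsilon> h)"

text \<open>For upper tuples \<open>\<upsilon> x \<ge> x\<close>, so the subtraction below does not truncate.\<close>

definition core :: "nat \<Rightarrow> (nat \<Rightarrow> nat) \<Rightarrow> (nat \<Rightarrow> nat) \<Rightarrow> nat \<Rightarrow> nat" where
  "core n lam \<upsilon> = (\<lambda>i\<in>{1..n}.
    if i \<in> critical n lam \<upsilon> then \<upsilon> i
    else let x = (LEAST x. x \<in> critical n lam \<upsilon> \<and> i < x) in \<upsilon> x - (x - i))"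

definition UGC_tuples :: "nat \<Rightarrow> (nat \<Rightarrow> nat) \<Rightarrow> (nat \<Rightarrow> nat) set" where
  "UGC_tuples n lam = {\<upsilon> \<in> U_tuples n. core n lam \<upsilon> \<in> UG_tuples n lam}"

type_synonym tableau = "nat \<times> nat \<Rightarrow> nat"

definition tableaux :: "nat \<Rightarrow> (nat \<Rightarrow> nat) \<Rightarrow> tableau set" where
  "tableaux n lam = {T \<in> boxes n lam \<rightarrow>\<^sub>E {1..n}.
    (\<forall>j i i'. (j, i) \<in> boxes n lam \<and> (j, i') \<in> boxes n lam \<and> i < i' \<longrightarrow> T (j, i) < T (j, i')) \<and>
    (\<forall>j j' i. (j, i) \<in> boxes n lam \<and> (j', i) \<in> boxes n lam \<and> j < j' \<longrightarrow> T (j, i) \<le> T (j', i))}"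

definition row_bound_set :: "nat \<Rightarrow> (nat \<Rightarrow> nat) \<Rightarrow> (nat \<Rightarrow> nat) \<Rightarrow> tableau set" where
  "row_bound_set n lam \<beta> = {T \<in> tableaux n lam. \<forall>(j, i)\<in>boxes n lam. T (j, i) \<le> \<beta> i}"

definition key_columns :: "nat \<Rightarrow> (nat \<Rightarrow> nat) \<Rightarrow> (nat \<Rightarrow> nat) \<Rightarrow> nat list list" where
  "key_columns n lam \<pi> =
    replicate (lam n) [1..<n + 1] @
    concat (map (\<lambda>h. replicate (lam (qpos n lam h) - lam (qpos n lam (h + 1)))
                       (sorted_list_of_set (\<pi> ` {1..qpos n lam h})))
                (rev [1..<r_num n lam + 1]))"

definition key_tableau :: "nat \<Rightarrow> (nat \<Rightarrow> nat) \<Rightarrow> (nat \<Rightarrow> nat) \<Rightarrow> tableau" where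
  "key_tableau n lam \<pi> = (\<lambda>(j, i)\<in>boxes n lam. key_columns n lam \<pi> ! (j - 1) ! (i - 1))"

text \<open>Earliest weakly increasing subsequence of a list of boxes, compared through their values.\<close>

function ewis :: "('b \<Rightarrow> nat) \<Rightarrow> 'b list \<Rightarrow> 'b list" where
  "ewis f [] = []"
| "ewis f (x # xs) = x # ewis f (dropWhile (\<lambda>y. f y < f x) xs)"
  by pat_completeness auto
termination
  by (relation "measure (\<lambda>(f, xs). length xs)") (auto simp: less_Suc_eq_le length_dropWhile_le)

text \<open>\<open>M\<close> is the set of boxes that are still unmarked.\<close>

definition scan_path :: "tableau \<Rightarrow> (nat \<times> nat) set \<Rightarrow> (nat \<times> nat) list" where
  "scan_path T M = ewis T (map (\<lambda>c. (c, Max {i. (c, i) \<in> M})) (sorted_list_of_set (fst ` M)))"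

text \<open>The boxes still unmarked after \<open>k\<close> rounds of the computation of column \<open>j\<close>.\<close>

primrec unmarked ::
    "nat \<Rightarrow> (nat \<Rightarrow> nat) \<Rightarrow> tableau \<Rightarrow> nat \<Rightarrow> nat \<Rightarrow> (nat \<times> nat) set" where
  "unmarked n lam T j 0 = {(c, i) \<in> boxes n lam. j \<le> c}"
| "unmarked n lam T j (Suc k) =
    unmarked n lam T j k - set (scan_path T (unmarked n lam T j k))"

text \<open>Column \<open>j\<close> is filled from the bottom, so box \<open>(j, i)\<close> is filled after \<open>\<zeta>\<^sub>j - i\<close> rounds.\<close>

definition scanning_tableau :: "nat \<Rightarrow> (nat \<Rightarrow> nat) \<Rightarrow> tableau \<Rightarrow> tableau" where
  "scanning_tableau n lam T = (\<lambda>(j, i)\<in>boxes n lam.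
    T (last (scan_path T (unmarked n lam T j (col_length n lam j - i)))))"

definition demazure_set :: "nat \<Rightarrow> (nat \<Rightarrow> nat) \<Rightarrow> (nat \<Rightarrow> nat) \<Rightarrow> tableau set" where
  "demazure_set n lam \<pi> = {T \<in> tableaux n lam.
    \<forall>b\<in>boxes n lam. scanning_tableau n lam T b \<le> key_tableau n lam \<pi> b}"

text \<open>Integer polynomials in variables indexed by \<open>nat\<close>: coefficients indexed by exponent vectors.\<close>

type_synonym polynomial = "(nat \<Rightarrow>\<^sub>0 nat) \<Rightarrow>\<^sub>0 int"

definition var_x :: "nat \<Rightarrow> polynomial" where
  "var_x i = Poly_Mapping.single (Poly_Mapping.single i 1) 1"

definition tab_content :: "nat \<Rightarrow> (nat \<Rightarrow> nat) \<Rightarrow> tableau \<Rightarrow> nat \<Rightarrow> nat" where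
  "tab_content n lam T i = card {b \<in> boxes n lam. T b = i}"

definition tab_weight :: "nat \<Rightarrow> (nat \<Rightarrow> nat) \<Rightarrow> tableau \<Rightarrow> polynomial" where
  "tab_weight n lam T = (\<Prod>i\<in>{1..n}. var_x i ^ tab_content n lam T i)"

text \<open>
  Identity of generating functions refers to the tableau sets and not only to the polynomials, so
  a generating function is a polynomial together with the shape and the set it is summed over.
\<close>

record tableau_gf =
  gf_shape :: "nat \<Rightarrow> nat"
  gf_tableaux :: "tableau set"
  gf_poly :: polynomial

definition tableau_sum :: "nat \<Rightarrow> (nat \<Rightarrow> nat) \<Rightarrow> tableau set \<Rightarrow> tableau_gf" where
  "tableau_sum n lam X =
    \<lparr>gf_shape = lam, gf_tableaux = X, gf_poly = (\<Sum>T\<in>X. tab_weight n lam T)\<rparr>"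

definition identical_gf :: "tableau_gf \<Rightarrow> tableau_gf \<Rightarrow> bool" where
  "identical_gf f g \<longleftrightarrow> gf_shape f = gf_shape g \<and> gf_tableaux f = gf_tableaux g"

definition row_bound_sum :: "nat \<Rightarrow> (nat \<Rightarrow> nat) \<Rightarrow> (nat \<Rightarrow> nat) \<Rightarrow> tableau_gf" where
  "row_bound_sum n lam \<beta> = tableau_sum n lam (row_bound_set n lam \<beta>)"

definition demazure_poly :: "nat \<Rightarrow> (nat \<Rightarrow> nat) \<Rightarrow> (nat \<Rightarrow> nat) \<Rightarrow> tableau_gf" where
  "demazure_poly n lam \<pi> = tableau_sum n lam (demazure_set n lam \<pi>)"

definition flag_schur_polys :: "nat \<Rightarrow> (nat \<Rightarrow> nat) \<Rightarrow> tableau_gf set" where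
  "flag_schur_polys n lam = row_bound_sum n lam ` UF_tuples n"

end

theory Submission
  imports Defs
begin

text \<open>
  Write \<open>B\<^sub>h\<close> for the set of the first \<open>q\<^sub>h\<close> values of \<open>\<pi>\<close>. The earliest weakly increasing
  subsequence of a sequence consists of its weak left-to-right maxima, so each entry of the scanning
  tableau is a maximum of entries of \<open>T\<close>; in particular \<open>T \<le> S(T)\<close>, and a Demazure set is contained
  in a row bound set. Conversely, 312-avoidance says that if \<open>b \<in> B\<^sub>h\<close> is missing from an earlier
  \<open>B\<^sub>g\<close>, then \<open>B\<^sub>h\<close> contains the whole interval from \<open>b\<close> to the maximum of \<open>B\<^sub>g\<close>. Going up the rows
  of a column, this keeps the entries of \<open>S(T)\<close> below those of the key as soon as \<open>T\<close> itself is below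
  the key, which gives \<open>D\<^sub>\<lambda>(\<pi>) = S\<^sub>\<lambda>(\<Psi>(\<pi>))\<close>. Row bound sets do not change when a tuple is
  replaced by its core, nor when a gapless tuple is replaced by its running maximum, and
  \<open>\<Psi> \<circ> \<Pi>\<close> is the identity on gapless tuples. Since a key is its own scanning tableau, distinct
  permutations have distinct Demazure sets.
\<close>

subsection \<open>Order statistics of finite sets\<close>

text \<open>Scanning values decrease strictly on the way up a column, and an element of a finite set
  that lies strictly below its (i+1)-st smallest element is at most its i-th smallest. So a value
  known to lie in \<open>B\<^sub>h\<close> inherits its bound from the row below; any other value is
  bounded by counting the elements beneath it. This alternative serves twice, to put
  \<open>T\<close> below the key and then to put \<open>S(T)\<close> below it. The gap to bridge:
  \<open>Psi\<close> bounds row i by the key set at the end of the carrel of i, while a longer key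
  column may have a smaller entry in that row. The statements about tuples rest on one remark: by
  strict increase down a column, a bound b in row x forces b - (x - i) in row i, and columns never
  end inside a carrel. A bound may thus be lowered to this value or raised back without changing the
  tableau set. The core lowers bounds to such runs of unit steps. The gapless condition says that
  after a descent the next carrel climbs back in unit steps, which is what lets the running maximum
  raise them.\<close>

definition kth :: "nat set \<Rightarrow> nat \<Rightarrow> nat" where
  "kth Q i = sorted_list_of_set Q ! (i - 1)"

lemma kth_in:
  assumes "finite Q" "1 \<le> i" "i \<le> card Q"
  shows "kth Q i \<in> Q"
proof -
  have "kth Q i \<in> set (sorted_list_of_set Q)"
    unfolding kth_def using assms by (intro nth_mem) simp
  then show ?thesis
    using assms by simp
qed

lemma kth_strict:
  assumes "finite Q" "1 \<le> i" "i < k" "k \<le> card Q"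
  shows "kth Q i < kth Q k"
  unfolding kth_def
  by (rule sorted_wrt_nth_less[of "(<)"]) (use assms in auto)

lemma kth_mono:
  assumes "finite Q" "1 \<le> i" "i \<le> k" "k \<le> card Q"
  shows "kth Q i \<le> kth Q k"
  using kth_strict[of Q i k] assms by (cases "i = k") auto

lemma kth_surj:
  assumes "finite Q" "x \<in> Q"
  obtains i where "1 \<le> i" "i \<le> card Q" "kth Q i = x"
proof -
  have "x \<in> set (sorted_list_of_set Q)"
    using assms by simp
  then obtain m where "m < card Q" "sorted_list_of_set Q ! m = x"
    by (metis in_set_conv_nth length_sorted_list_of_set)
  then show ?thesis
    using that[of "Suc m"] by (simp add: kth_def)
qed

lemma kth_le_imp_le:
  assumes "finite Q" "1 \<le> i" "i \<le> card Q" "1 \<le> k" "k \<le> card Q" "kth Q i \<le> kth Q k"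
  shows "i \<le> k"
  using kth_strict[of Q k i] assms by (meson leD leI)

lemma card_less_kth:
  assumes "finite Q" "1 \<le> i" "i \<le> card Q"
  shows "card {y \<in> Q. y < kth Q i} = i - 1"
proof -
  have eq: "{y \<in> Q. y < kth Q i} = kth Q ` {1..<i}"
  proof (intro equalityI subsetI)
    fix y assume y: "y \<in> {y \<in> Q. y < kth Q i}"
    then obtain k where k: "1 \<le> k" "k \<le> card Q" "kth Q k = y"
      using kth_surj[OF assms(1)] by blast
    then have "k < i"
      using y kth_mono[of Q i k] assms by (metis (mono_tags, lifting) leD leI mem_Collect_eq)
    then show "y \<in> kth Q ` {1..<i}"
      using k by auto
  next
    fix y assume "y \<in> kth Q ` {1..<i}"
    then show "y \<in> {y \<in> Q. y < kth Q i}"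
      using assms kth_in[of Q] kth_strict[of Q] by auto
  qed
  have "inj_on (kth Q) {1..<i}"
  proof (rule linorder_inj_onI)
    fix x y assume "x < y" "x \<in> {1..<i}" "y \<in> {1..<i}"
    then show "kth Q x \<noteq> kth Q y"
      using kth_strict[of Q x y] assms by auto
  qed auto
  then show ?thesis
    unfolding eq by (simp add: card_image)
qed

text \<open>Reduces a bound by an order statistic to a count, so that it transfers between any two
  sets that agree below \<open>x\<close>; this is how bounds pass between key columns of different
  lengths.\<close>

lemma le_kth_iff:
  assumes "finite Q" "1 \<le> i" "i \<le> card Q"
  shows "x \<le> kth Q i \<longleftrightarrow> card {y \<in> Q. y < x} < i"
proof
  assume "x \<le> kth Q i"
  then have "card {y \<in> Q. y < x} \<le> card {y \<in> Q. y < kth Q i}"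
    using assms by (intro card_mono) auto
  then show "card {y \<in> Q. y < x} < i"
    using card_less_kth[OF assms] assms by simp
next
  assume less: "card {y \<in> Q. y < x} < i"
  show "x \<le> kth Q i"
  proof (rule ccontr)
    assume "\<not> x \<le> kth Q i"
    then have "insert (kth Q i) {y \<in> Q. y < kth Q i} \<subseteq> {y \<in> Q. y < x}"
      using kth_in[OF assms] by auto
    then have "card (insert (kth Q i) {y \<in> Q. y < kth Q i}) \<le> card {y \<in> Q. y < x}"
      using assms by (intro card_mono) auto
    then show False
      using less card_less_kth[OF assms] assms by simp
  qed
qed

lemma kth_eqI:
  assumes "finite Q" "x \<in> Q" "card {y \<in> Q. y < x} = i - 1" "1 \<le> i"
  shows "kth Q i = x"
proof -
  obtain k where k: "1 \<le> k" "k \<le> card Q" "kth Q k = x"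
    using kth_surj[OF assms(1,2)] .
  then have "k - 1 = i - 1"
    using card_less_kth[OF assms(1) k(1,2)] assms(3) by simp
  then show ?thesis
    using k assms(4) by (metis le_add_diff_inverse)
qed

text \<open>No element of \<open>Q\<close> lies strictly between consecutive order statistics. This
  drives the inductions up a column.\<close>

lemma le_kth_of_less:
  assumes "finite Q" "1 \<le> i" "Suc i \<le> card Q" "x \<in> Q" "x < kth Q (Suc i)"
  shows "x \<le> kth Q i"
proof -
  obtain k where k: "1 \<le> k" "k \<le> card Q" "kth Q k = x"
    using kth_surj[OF assms(1,4)] .
  have "\<not> Suc i \<le> k"
    using kth_mono[of Q "Suc i" k] k assms by auto
  then show ?thesis
    using kth_mono[of Q k i] k assms by auto
qed

lemma kth_card_eq_Max:
  assumes "finite Q" "Q \<noteq> {}"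
  shows "kth Q (card Q) = Max Q"
proof (rule Max_eqI[symmetric])
  have "1 \<le> card Q"
    using assms by (simp add: Suc_leI card_gt_0_iff)
  then show "kth Q (card Q) \<in> Q"
    using kth_in assms by blast
  fix y assume "y \<in> Q"
  then obtain k where k: "1 \<le> k" "k \<le> card Q" "kth Q k = y"
    using kth_surj[OF assms(1)] by blast
  then show "y \<le> kth Q (card Q)"
    using kth_mono[of Q k "card Q"] assms by auto
qed (use assms in auto)

text \<open>Only the \<open>i - 1\<close> positive numbers below \<open>i\<close> can precede the
  \<open>i\<close>-th element; this makes \<open>Psi\<close> an upper tuple.\<close>

lemma index_le_kth:
  assumes "finite Q" "0 \<notin> Q" "1 \<le> i" "i \<le> card Q"
  shows "i \<le> kth Q i"
proof -
  have "card {y \<in> Q. y < i} \<le> card {1..<i}"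
    using assms(2) by (intro card_mono) (auto simp: Suc_le_eq intro: gr0I)
  then show ?thesis
    using le_kth_iff[OF assms(1,3,4)] assms(3) by simp
qed

lemma rank_desc_eq_kth:
  assumes "finite Q" "1 \<le> d" "d \<le> card Q"
  shows "rank_desc d Q = kth Q (card Q - d + 1)"
  using assms by (simp add: rank_desc_def kth_def rev_nth)

subsection \<open>Lists\<close>

text \<open>The block lengths telescope: the copies of \<open>X h\<close> occupy the positions from
  \<open>f (Suc h)\<close> up to, but excluding, \<open>f h\<close>. The downward induction on
  \<open>m\<close> appends the block of \<open>X m\<close> at the right end. It is applied to key
  columns with \<open>f h = lam (q h)\<close>.\<close>

lemma nth_blocks:
  fixes f :: "nat \<Rightarrow> nat" and X :: "nat \<Rightarrow> 'b"
  assumes anti: "\<And>h. 1 \<le> h \<Longrightarrow> h \<le> R \<Longrightarrow> f (Suc h) \<le> f h"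
    and "1 \<le> m" "m \<le> Suc R"
  defines "K \<equiv> \<lambda>m. replicate (f (Suc R)) (X (Suc R)) @
    concat (map (\<lambda>h. replicate (f h - f (h + 1)) (X h)) (rev [m..<Suc R]))"
  shows "length (K m) = f m \<and>
    (\<forall>h k. m \<le> h \<and> h \<le> Suc R \<and> k < f h \<and> (h \<le> R \<longrightarrow> f (Suc h) \<le> k) \<longrightarrow> K m ! k = X h)"
  using assms(3,2)
proof (induction rule: inc_induct)
  case base
  have "h = Suc R" if "h \<le> Suc R" "\<not> h \<le> R" for h
    using that by simp
  then show ?case
    by (fastforce simp: K_def)
next
  case (step m)
  have "1 \<le> Suc m"
    by simp
  note IH' = step.IH[OF this]
  note IH = conjunct1[OF IH'] conjunct2[OF IH', rule_format]
  have K: "K m = K (Suc m) @ replicate (f m - f (Suc m)) (X m)"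
    using step(2) by (simp add: K_def upt_conv_Cons del: upt_Suc)
  have anti': "f h \<le> f (Suc m)" if "Suc m \<le> h" "h \<le> Suc R" for h
    using that
  proof (induction rule: dec_induct)
    case (step i)
    then show ?case
      using anti[of i] by simp
  qed simp
  have "K m ! k = X h"
    if "m \<le> h" "h \<le> Suc R" "k < f h" "h \<le> R \<longrightarrow> f (Suc h) \<le> k" for h k
  proof (cases "h = m")
    case True
    then show ?thesis
      using that step(2) IH(1) by (simp add: K nth_append)
  next
    case False
    then have "k < f (Suc m)"
      using anti'[of h] that by simp
    then show ?thesis
      using IH(1) IH(2)[of h k] that False by (simp add: K nth_append)
  qed
  then show ?case
    using step.hyps step.prems anti[of m] IH(1) by (auto simp: K)
qed

lemma ewis_dropWhile_Cons:
  "ewis f (dropWhile (\<lambda>y. f y < m) (y # ys)) =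
    (if f y < m then ewis f (dropWhile (\<lambda>y. f y < m) ys) else y # ewis f (dropWhile (\<lambda>x. f x < f y) ys))"
  by simp

text \<open>Generalized over a threshold \<open>m\<close>, the value taken last, because each
  recursive call of \<open>ewis\<close> first drops everything below it. Dropped elements do not
  constrain later ones, which have value at least \<open>m\<close>.\<close>

lemma set_ewis_dropWhile:
  fixes cs :: "nat list"
  assumes "sorted_wrt (<) cs"
  shows "set (ewis f (dropWhile (\<lambda>y. f y < m) (map g cs))) =
    g ` {c \<in> set cs. m \<le> f (g c) \<and> (\<forall>c'\<in>set cs. c' < c \<longrightarrow> f (g c') \<le> f (g c))}"
  using assms
proof (induction cs arbitrary: m)
  case (Cons c cs)
  have less: "c < d" "\<not> d < c" if "d \<in> set cs" for d
    using that Cons.prems by auto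
  have "{d \<in> set (c # cs). m \<le> f (g d) \<and> (\<forall>c'\<in>set (c # cs). c' < d \<longrightarrow> f (g c') \<le> f (g d))} =
    (if f (g c) < m then {d \<in> set cs. m \<le> f (g d) \<and> (\<forall>c'\<in>set cs. c' < d \<longrightarrow> f (g c') \<le> f (g d))}
     else insert c {d \<in> set cs. f (g c) \<le> f (g d) \<and> (\<forall>c'\<in>set cs. c' < d \<longrightarrow> f (g c') \<le> f (g d))})"
    by (auto simp: less)
  then show ?case
    using Cons.IH Cons.prems by (simp del: dropWhile.simps ewis.simps add: ewis_dropWhile_Cons)
qed simp

lemma set_ewis:
  fixes cs :: "nat list"
  assumes "sorted_wrt (<) cs"
  shows "set (ewis f (map g cs)) = g ` {c \<in> set cs. \<forall>c'\<in>set cs. c' < c \<longrightarrow> f (g c') \<le> f (g c)}"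
  using set_ewis_dropWhile[OF assms, of f 0 g] by (simp add: dropWhile_eq_self_iff)

lemma le_last_ewis:
  "y \<in> set (x # xs) \<Longrightarrow> f y \<le> f (last (ewis f (x # xs)))"
proof (induction xs arbitrary: x y)
  case (Cons a xs)
  show ?case
  proof (cases "f a < f x")
    case True
    then show ?thesis
      using Cons.IH[of x x] Cons.IH[of y x] Cons.prems by auto
  next
    case False
    then show ?thesis
      using Cons.IH[of a a] Cons.IH[of y a] Cons.prems by auto
  qed
qed simp

subsection \<open>Filling one carrel\<close>

text \<open>
  \<open>a\<close> and \<open>e\<close> are consecutive carrel ends, \<open>m\<close> is the value of \<open>\<gamma>\<close> at \<open>a\<close>, and \<open>s\<close> is the overlap.
  The new small values are the largest \<open>s\<close> gaps below \<open>m\<close>, so the image of \<open>{1..e}\<close> contains an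
  interval ending at \<open>m\<close> of length at least \<open>s\<close>.
\<close>

lemma Pi_step:
  fixes a e m s :: nat and \<gamma> \<rho> :: "nat \<Rightarrow> nat"
  assumes ae: "a < e"
    and inj: "inj_on \<rho> {1..a}" and sub: "\<rho> ` {1..a} \<subseteq> {1..m}"
    and incr: "\<And>i k. a < i \<Longrightarrow> i < k \<Longrightarrow> k \<le> e \<Longrightarrow> \<gamma> i < \<gamma> k"
    and upper: "\<And>i. a < i \<Longrightarrow> i \<le> e \<Longrightarrow> i \<le> \<gamma> i"
    and s: "s = (if \<gamma> (a + 1) \<le> m then m - \<gamma> (a + 1) + 1 else 0)"
    and gap: "a + s \<le> e" "\<And>t. 1 \<le> t \<Longrightarrow> t \<le> s \<Longrightarrow> \<gamma> (a + t) = m - s + t"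
    and \<sigma>: "\<And>i. \<sigma> i = (if i \<le> a then \<rho> i
        else if i \<le> a + s then rank_desc (a + s - i + 1) ({1..m} - \<rho> ` {1..a}) else \<gamma> i)"
  shows "inj_on \<sigma> {1..e}" "\<sigma> ` {1..e} \<subseteq> {1..\<gamma> e}"
    "\<And>i k. a < i \<Longrightarrow> i < k \<Longrightarrow> k \<le> e \<Longrightarrow> \<sigma> i < \<sigma> k"
    "\<And>i. a < i \<Longrightarrow> i \<le> e \<Longrightarrow> kth (\<sigma> ` {1..e}) i = \<gamma> i"
    "\<And>b c y. b \<in> \<sigma> ` {1..e} - \<sigma> ` {1..a} \<Longrightarrow> c \<in> \<sigma> ` {1..a} \<Longrightarrow> b \<le> y \<Longrightarrow> y \<le> c \<Longrightarrow> y \<in> \<sigma> ` {1..e}"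
proof -
  define A where "A = \<rho> ` {1..a}"
  define N where "N = {1..m} - A"
  define k0 where "k0 = card N - s"
  let ?B = "\<sigma> ` {1..e}"
  have cardA: "card A = a"
    using inj by (simp add: A_def card_image)
  have finN: "finite N" and cardN: "card N = m - a"
    using sub cardA unfolding N_def A_def[symmetric] by (auto simp: card_Diff_subset finite_subset)
  \<comment> \<open>There are \<open>m - a\<close> gaps, and upperness at \<open>a + 1\<close> gives
    \<open>\<gamma> (a + 1) \<ge> a + 1\<close>, hence \<open>s \<le> m - a\<close>.\<close>
  have sN: "s \<le> card N"
    using s upper[of "a + 1"] ae cardN by auto
  have k0: "k0 + s = card N"
    using sN by (simp add: k0_def)
  have low: "\<sigma> i = \<rho> i" if "i \<le> a" for i
    using that by (simp add: \<sigma>)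
  have A: "\<sigma> ` {1..a} = A"
    unfolding A_def by (intro image_cong) (auto simp: low)
  have mid: "\<sigma> i = kth N (k0 + (i - a))" if "a < i" "i \<le> a + s" for i
  proof -
    have "\<sigma> i = rank_desc (a + s - i + 1) N"
      using that by (simp add: \<sigma> N_def A_def)
    also have "\<dots> = kth N (card N - (a + s - i + 1) + 1)"
      using that sN by (intro rank_desc_eq_kth finN) auto
    also have "card N - (a + s - i + 1) + 1 = k0 + (i - a)"
      using that sN by (simp add: k0_def)
    finally show ?thesis .
  qed
  have mid_in: "\<sigma> i \<in> N" if "a < i" "i \<le> a + s" for i
    unfolding mid[OF that] using that sN by (intro kth_in finN) (auto simp: k0_def)
  have high: "\<sigma> i = \<gamma> i" if "a + s < i" for i
    using that by (simp add: \<sigma>)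
  have above: "m < \<gamma> i" if "a + s < i" "i \<le> e" for i
  proof (cases "s = 0")
    case True
    then have "m < \<gamma> (a + 1)"
      using s by (auto split: if_splits)
    also have "\<gamma> (a + 1) \<le> \<gamma> i"
      using incr[of "a + 1" i] that by (cases "i = a + 1") auto
    finally show ?thesis .
  next
    case False
    then have "s \<le> m"
      using sN cardN by simp
    then have "\<gamma> (a + s) = m"
      using gap(2)[of s] False by simp
    then show ?thesis
      using incr[of "a + s" i] that False by simp
  qed
  have le_m: "\<sigma> i \<le> m" if "1 \<le> i" "i \<le> a + s" for i
  proof (cases "i \<le> a")
    case True
    then have "\<sigma> i \<in> A"
      using that A by auto
    then show ?thesis
      using sub by (auto simp: A_def)
  next
    case False
    then show ?thesis
      using mid_in[of i] that by (simp add: N_def)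
  qed
  show strict: "\<sigma> i < \<sigma> k" if ik: "a < i" "i < k" "k \<le> e" for i k
  proof -
    consider "k \<le> a + s" | "i \<le> a + s" "a + s < k" | "a + s < i"
      by linarith
    then show ?thesis
    proof cases
      case 1
      then have "kth N (k0 + (i - a)) < kth N (k0 + (k - a))"
        using ik sN by (intro kth_strict finN) (auto simp: k0_def)
      then show ?thesis
        using mid[of i] mid[of k] 1 ik by simp
    next
      case 2
      then show ?thesis
        using le_m[of i] above[of k] high[of k] ik by simp
    next
      case 3
      then show ?thesis
        using high[of i] high[of k] incr ik by simp
    qed
  qed
  have new: "\<sigma> i \<notin> A" if "a < i" "i \<le> e" for i
  proof (cases "i \<le> a + s")
    case True
    then show ?thesis
      using mid_in that by (simp add: N_def)
  next
    case False
    then have "m < \<sigma> i"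
      using above[of i] high[of i] that by simp
    then show ?thesis
      using sub by (auto simp: A_def)
  qed
  show injs: "inj_on \<sigma> {1..e}"
  proof (rule linorder_inj_onI)
    fix i k assume ik: "i < k" "i \<in> {1..e}" "k \<in> {1..e}"
    consider "k \<le> a" | "i \<le> a" "a < k" | "a < i"
      by linarith
    then show "\<sigma> i \<noteq> \<sigma> k"
    proof cases
      case 1
      then have "\<rho> i \<noteq> \<rho> k"
        using inj ik by (auto dest: inj_onD)
      then show ?thesis
        using 1 ik low by simp
    next
      case 2
      then have "\<sigma> i \<in> A"
        using ik A by auto
      then show ?thesis
        using new[of k] 2 ik by auto
    next
      case 3
      then show ?thesis
        using strict[of i k] ik by simp
    qed
  qed auto
  have m_le: "m \<le> \<gamma> e"
  proof (cases "a + s < e")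
    case True
    then show ?thesis
      using above[of e] by simp
  next
    case False
    then show ?thesis
      using gap(1) gap(2)[of s] ae sN cardN by simp
  qed
  show "?B \<subseteq> {1..\<gamma> e}"
  proof
    fix x assume "x \<in> ?B"
    then obtain i where i: "x = \<sigma> i" "1 \<le> i" "i \<le> e" by auto
    show "x \<in> {1..\<gamma> e}"
    proof (cases "i \<le> a + s")
      case True
      then have "1 \<le> \<sigma> i"
      proof (cases "i \<le> a")
        case True
        then have "\<sigma> i \<in> A"
          unfolding A[symmetric] using i by simp
        then show ?thesis
          using sub unfolding A_def[symmetric] by auto
      next
        case False
        then show ?thesis
          using mid_in[of i] True by (simp add: N_def)
      qed
      then show ?thesis
        using le_m[of i] True i m_le by simp
    next
      case False
      then have "\<gamma> i \<le> \<gamma> e"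
        using incr[of i e] i by (cases "i = e") auto
      then show ?thesis
        using high[of i] above[of i] False i by simp
    qed
  qed
  have image_split: "?B = \<sigma> ` {1..a + s} \<union> \<sigma> ` {a + s<..e}"
  proof -
    have "{1..e} = {1..a + s} \<union> {a + s<..e}"
      using gap(1) by auto
    then show ?thesis
      by (simp only: image_Un)
  qed
  \<comment> \<open>Since \<open>b \<le> c \<le> m\<close>, the new value \<open>b\<close> is one of
    the chosen gaps. These form a top segment of \<open>N\<close>, so every gap from
    \<open>b\<close> to \<open>m\<close> is chosen too.\<close>
  show "y \<in> ?B" if b: "b \<in> ?B - \<sigma> ` {1..a}" and c: "c \<in> \<sigma> ` {1..a}" and y: "b \<le> y" "y \<le> c" for b c y
  proof (cases "y \<in> A")
    case True
    then show ?thesis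
      using ae unfolding A[symmetric] by auto
  next
    case False
    have "c \<le> m"
      using c le_m by auto
    obtain i where i: "b = \<sigma> i" "1 \<le> i" "i \<le> e"
      using b by auto
    have "a < i"
      using b i by (cases "a < i") auto
    have "i \<le> a + s"
      using above[of i] high[of i] i y \<open>c \<le> m\<close> by (cases "i \<le> a + s") auto
    have "b \<in> N"
      using mid_in[OF \<open>a < i\<close> \<open>i \<le> a + s\<close>] i by simp
    then have "y \<in> N"
      using False y \<open>c \<le> m\<close> by (simp add: N_def)
    then obtain k where k: "1 \<le> k" "k \<le> card N" "kth N k = y"
      using kth_surj[OF finN] by blast
    have "kth N (k0 + (i - a)) \<le> kth N k"
      using mid[OF \<open>a < i\<close> \<open>i \<le> a + s\<close>] i y k by simp
    moreover have "1 \<le> k0 + (i - a)" "k0 + (i - a) \<le> card N"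
      using k0 \<open>a < i\<close> \<open>i \<le> a + s\<close> by linarith+
    ultimately have "k0 + (i - a) \<le> k"
      using kth_le_imp_le[OF finN] k(1,2) by blast
    then have "k0 < k" "k \<le> k0 + s"
      using k(2) k0 \<open>a < i\<close> by linarith+
    then have "\<sigma> (a + (k - k0)) = y" "a + (k - k0) \<le> a + s"
      using mid[of "a + (k - k0)"] k(3) by simp_all
    then show ?thesis
      using gap(1) \<open>k0 + (i - a) \<le> k\<close> \<open>a < i\<close> by (intro image_eqI[of _ _ "a + (k - k0)"]) auto
  qed
  show "kth ?B i = \<gamma> i" if i: "a < i" "i \<le> e" for i
  proof (cases "i \<le> a + s")
    case False
    show ?thesis
    proof (rule kth_eqI)
      have "\<sigma> k < \<gamma> i \<longleftrightarrow> k < i" if "k \<in> {1..e}" for k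
      proof (cases "k \<le> a + s")
        case True
        then show ?thesis
          using le_m[of k] above[of i] that False i by simp
      next
        case high_k: False
        then show ?thesis
          using high[of k] incr[of i k] incr[of k i] that i by (cases i k rule: linorder_cases) auto
      qed
      then have "{y \<in> ?B. y < \<gamma> i} = \<sigma> ` {1..<i}"
        using i by auto
      moreover have "inj_on \<sigma> {1..<i}"
        using i by (intro inj_on_subset[OF injs]) auto
      ultimately show "card {y \<in> ?B. y < \<gamma> i} = i - 1"
        by (simp add: card_image)
      show "\<gamma> i \<in> ?B"
        using high[of i] False i by (intro image_eqI[of _ _ i]) auto
    qed (use i in auto)
  next
    case True
    have sm: "s \<le> m"
      using sN cardN by simp
    have gi: "\<gamma> i = m - s + (i - a)"
      using gap(2)[of "i - a"] True i by simp
    let ?B' = "\<sigma> ` {1..a + s}"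
    \<comment> \<open>The interval has length \<open>s\<close>, so at most \<open>s\<close> gaps lie
      at or above a point \<open>y\<close> of it; if \<open>y\<close> is a gap, it is among the
      \<open>s\<close> largest.\<close>
    have int: "{m - s + 1..m} \<subseteq> ?B'"
    proof
      fix y assume y: "y \<in> {m - s + 1..m}"
      show "y \<in> ?B'"
      proof (cases "y \<in> A")
        case True
        then show ?thesis
          unfolding A[symmetric] by auto
      next
        case False
        then have "y \<in> N"
          using y by (simp add: N_def)
        then obtain k where k: "1 \<le> k" "k \<le> card N" "kth N k = y"
          using kth_surj[OF finN] by blast
        have "N \<subseteq> {x \<in> N. x < y} \<union> {y..m}"
          by (auto simp: N_def)
        then have "card N \<le> card ({x \<in> N. x < y} \<union> {y..m})"
          using finN by (intro card_mono) auto
        also have "\<dots> \<le> card {x \<in> N. x < y} + card {y..m}"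
          by (rule card_Un_le)
        also have "card {x \<in> N. x < y} = k - 1"
          using card_less_kth[OF finN k(1,2)] k(3) by simp
        finally have "card N \<le> k - 1 + s"
          using y sm by auto
        then have "k0 < k"
          using k(1) k0 by linarith
        then have "a < a + (k - k0)" "a + (k - k0) \<le> a + s"
          using k(2) k0 by linarith+
        moreover from this have "\<sigma> (a + (k - k0)) = y"
          using mid[of "a + (k - k0)"] k(3) \<open>k0 < k\<close> by simp
        ultimately have "\<sigma> (a + (k - k0)) = y" "a + (k - k0) \<in> {1..a + s}"
          by simp_all
        then show ?thesis
          by blast
      qed
    qed
    have eq: "{y \<in> ?B. y < \<gamma> i} = {y \<in> ?B'. y < \<gamma> i}"
    proof -
      have "\<gamma> i \<le> m"
        using gi True sm by simp
      then show ?thesis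
        unfolding image_split using above high by fastforce
    qed
    have "m - s + 1 \<le> \<gamma> i" "\<gamma> i \<le> m"
      using gi i True sm by linarith+
    then have top: "{\<gamma> i..m} \<subseteq> ?B'" "\<gamma> i \<in> ?B'"
      using int by (auto simp: subset_eq)
    \<comment> \<open>Of the \<open>a + s\<close> values up to \<open>m\<close>, those from
      \<open>\<gamma> i\<close> on form a full interval; removing it leaves \<open>i - 1\<close>
      values below \<open>\<gamma> i\<close>.\<close>
    then have "?B' = {y \<in> ?B'. y < \<gamma> i} \<union> {\<gamma> i..m}"
      using le_m by auto
    then have "card ?B' = card ({y \<in> ?B'. y < \<gamma> i} \<union> {\<gamma> i..m})"
      by (rule arg_cong)
    also have "\<dots> = card {y \<in> ?B'. y < \<gamma> i} + card {\<gamma> i..m}"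
      by (rule card_Un_disjoint) auto
    finally have "card ?B' = card {y \<in> ?B'. y < \<gamma> i} + card {\<gamma> i..m}" .
    moreover have "card ?B' = a + s"
      using card_image[OF inj_on_subset[OF injs], of "{1..a + s}"] gap(1) by simp
    ultimately have "card {y \<in> ?B'. y < \<gamma> i} = i - 1"
      using gi True i sm by simp
    moreover have "\<gamma> i \<in> ?B"
      using top(2) unfolding image_split by blast
    ultimately show ?thesis
      using i eq by (intro kth_eqI) auto
  qed
qed

subsection \<open>Columns and carrels\<close>

locale shape =
  fixes n :: nat and lam :: "nat \<Rightarrow> nat"
  assumes n_pos: "1 \<le> n" and part: "is_partition n lam"
begin

abbreviation "q \<equiv> qpos n lam"
abbreviation "r \<equiv> r_num n lam"
abbreviation "z \<equiv> col_length n lam"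
abbreviation "bx \<equiv> boxes n lam"

lemma lam_antimono: "1 \<le> i \<Longrightarrow> i \<le> k \<Longrightarrow> k \<le> n \<Longrightarrow> lam k \<le> lam i"
  using part unfolding is_partition_def by auto

lemma z_le_n: "z j \<le> n"
proof -
  have "z j \<le> card {1..n}"
    unfolding col_length_def by (intro card_mono) auto
  then show ?thesis by simp
qed

text \<open>Conjugation of partitions: the rows with \<open>lam i \<ge> j\<close> form an initial
  segment of length \<open>z j\<close>.\<close>

lemma le_z_iff:
  assumes "1 \<le> k" "k \<le> n"
  shows "k \<le> z j \<longleftrightarrow> j \<le> lam k"
proof
  assume "j \<le> lam k"
  then have "{1..k} \<subseteq> {i \<in> {1..n}. j \<le> lam i}"
    using assms lam_antimono by (auto intro: order_trans)
  then have "card {1..k} \<le> z j"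
    unfolding col_length_def by (intro card_mono) auto
  then show "k \<le> z j" by simp
next
  assume k: "k \<le> z j"
  show "j \<le> lam k"
  proof (rule ccontr)
    assume "\<not> j \<le> lam k"
    then have "{i \<in> {1..n}. j \<le> lam i} \<subseteq> {1..<k}"
      using assms lam_antimono[of k] by (auto simp: not_le) (meson leD leI order_trans)
    then have "z j \<le> card {1..<k}"
      unfolding col_length_def by (intro card_mono) auto
    then show False
      using k assms by simp
  qed
qed

lemma z_pos: "j \<le> lam 1 \<Longrightarrow> 1 \<le> z j"
  using le_z_iff[of 1 j] n_pos by simp

lemma z_antimono: "j \<le> j' \<Longrightarrow> z j' \<le> z j"
  unfolding col_length_def by (intro card_mono) auto

lemma R_set_sub: "R_set n lam \<subseteq> {1..<n}"
  using z_pos unfolding R_set_def by auto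

lemma finite_R_set: "finite (R_set n lam)"
  using R_set_sub finite_subset by blast

lemma q_0 [simp]: "q 0 = 0"
  by (simp add: qpos_def)

lemma q_last [simp]: "q (Suc r) = n"
  by (simp add: qpos_def r_num_def nth_append finite_R_set)

lemma q_eq_kth: "1 \<le> h \<Longrightarrow> h \<le> r \<Longrightarrow> q h = kth (R_set n lam) h"
  by (cases h) (auto simp: qpos_def r_num_def nth_append kth_def finite_R_set)

lemma q_in_R: "1 \<le> h \<Longrightarrow> h \<le> r \<Longrightarrow> q h \<in> R_set n lam"
  using q_eq_kth kth_in[OF finite_R_set] unfolding r_num_def by auto

lemma R_set_q:
  assumes "x \<in> R_set n lam"
  obtains h where "1 \<le> h" "h \<le> r" "q h = x"
  using kth_surj[OF finite_R_set assms] q_eq_kth unfolding r_num_def by metis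

lemma q_strict:
  assumes "h < h'" "h' \<le> Suc r"
  shows "q h < q h'"
proof (cases "h = 0 \<or> h' = Suc r")
  case True
  have "h' \<le> r \<Longrightarrow> 0 < q h'"
    using q_in_R[of h'] R_set_sub assms by (auto simp: subset_eq)
  moreover have "1 \<le> h \<Longrightarrow> q h < n"
    using q_in_R[of h] R_set_sub assms by (auto simp: subset_eq)
  ultimately show ?thesis
    using True assms n_pos by (cases "h' = Suc r"; cases "h = 0") auto
next
  case False
  then show ?thesis
    using q_eq_kth[of h] q_eq_kth[of h'] kth_strict[OF finite_R_set, of h h'] assms
    by (auto simp: r_num_def)
qed

lemma q_mono: "h \<le> h' \<Longrightarrow> h' \<le> Suc r \<Longrightarrow> q h \<le> q h'"
  using q_strict[of h h'] by (cases "h = h'") auto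

lemma q_le_n: "h \<le> Suc r \<Longrightarrow> q h \<le> n"
  using q_mono[of h "Suc r"] by simp

lemma q_less_imp: "q h < q h' \<Longrightarrow> h \<le> Suc r \<Longrightarrow> h < h'"
  using q_mono[of h' h] by (meson leD leI)

text \<open>Carrels are addressed below by the index \<open>h \<le> r\<close> of their left end
  \<open>q h\<close>, which avoids the subtraction in \<open>carrel\<close>.\<close>

lemma carrel_Suc: "carrel n lam (Suc h) = {q h<..q (Suc h)}"
  by (simp add: carrel_def)

lemma carrel_ex:
  assumes "1 \<le> i" "i \<le> n"
  obtains h where "h \<le> r" "q h < i" "i \<le> q (Suc h)"
proof -
  define h where "h = (LEAST h. i \<le> q h)"
  have "i \<le> q h" "h \<le> Suc r"
    unfolding h_def using assms by (auto intro: LeastI[of _ "Suc r"] Least_le)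
  moreover have "h \<noteq> 0"
    using \<open>i \<le> q h\<close> assms by (intro notI) simp
  moreover have "\<not> i \<le> q (h - 1)"
    using not_less_Least[of "h - 1" "\<lambda>h. i \<le> q h"] \<open>h \<noteq> 0\<close> unfolding h_def by simp
  ultimately show ?thesis
    using that[of "h - 1"] by auto
qed

lemma carrel_index_eq:
  assumes "h \<le> r" "q h < i" "i \<le> q (Suc h)"
  shows "carrel_index n lam i = Suc h"
  unfolding carrel_index_def
proof (rule the_equality)
  show "Suc h \<in> {1..r + 1} \<and> i \<in> carrel n lam (Suc h)"
    using assms by (simp add: carrel_Suc)
  fix h' assume h': "h' \<in> {1..r + 1} \<and> i \<in> carrel n lam h'"
  then obtain g where g: "h' = Suc g" "g \<le> r"
    by (cases h') auto
  then have "q g < q (Suc h)" "q h < q (Suc g)"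
    using h' assms by (auto simp: carrel_Suc)
  then have "g < Suc h" "h < Suc g"
    using q_less_imp g assms by auto
  then show "h' = Suc h"
    using g by simp
qed

lemma z_eq_q:
  assumes "1 \<le> j" "j \<le> lam 1"
  obtains h where "1 \<le> h" "h \<le> Suc r" "z j = q h"
proof (cases "z j = n")
  case True
  then show ?thesis
    using that[of "Suc r"] by simp
next
  case False
  then have "z j \<in> R_set n lam"
    using assms z_le_n[of j] unfolding R_set_def by auto
  then show ?thesis
    using R_set_q that le_SucI by metis
qed

lemma column_of_length_q:
  assumes "1 \<le> h" "h \<le> r"
  obtains j where "1 \<le> j" "j \<le> lam 1" "z j = q h"
  using q_in_R[OF assms] that unfolding R_set_def by auto

lemma mem_boxes: "(j, i) \<in> bx \<longleftrightarrow> 1 \<le> j \<and> j \<le> lam 1 \<and> 1 \<le> i \<and> i \<le> z j"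
  unfolding boxes_def by auto

text \<open>Column lengths are carrel ends, so a column that enters a carrel runs through it. A row
  bound can therefore be compared with any bound further down in the same carrel.\<close>

lemma carrel_end_le_z:
  assumes "(j, i) \<in> bx" "h \<le> r" "q h < i"
  shows "q (Suc h) \<le> z j"
proof -
  obtain g where g: "1 \<le> g" "g \<le> Suc r" "z j = q g"
    using assms z_eq_q by (auto simp: mem_boxes)
  then have "q h < q g"
    using assms by (auto simp: mem_boxes)
  then have "h < g"
    using q_less_imp assms by simp
  then show ?thesis
    using g q_mono[of "Suc h" g] by simp
qed

lemma tab_col:
  assumes "T \<in> tableaux n lam" "(j, i') \<in> bx" "1 \<le> i" "i \<le> i'"
  shows "T (j, i) + (i' - i) \<le> T (j, i')"
  using assms(4,2)
proof (induction rule: dec_induct)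
  case (step m)
  have "(j, m) \<in> bx"
    using step assms(3) by (auto simp: mem_boxes)
  moreover have "T (j, m) < T (j, Suc m)"
    using assms(1) step \<open>(j, m) \<in> bx\<close> unfolding tableaux_def by blast
  ultimately show ?case
    using step by simp
qed simp

lemma tab_row:
  assumes "T \<in> tableaux n lam" "(j', i) \<in> bx" "1 \<le> j" "j \<le> j'"
  shows "T (j, i) \<le> T (j', i)"
proof (cases "j = j'")
  case False
  have "(j, i) \<in> bx"
    using assms z_antimono[of j j'] by (auto simp: mem_boxes)
  then show ?thesis
    using assms False unfolding tableaux_def
    by (metis (mono_tags, lifting) le_neq_implies_less mem_Collect_eq)
qed simp

subsection \<open>Keys\<close>

abbreviation key_set :: "(nat \<Rightarrow> nat) \<Rightarrow> nat \<Rightarrow> nat set" where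
  "key_set \<pi> h \<equiv> \<pi> ` {1..q h}"

lemma key_tableau_eq:
  assumes "(j, i) \<in> bx" "1 \<le> h" "h \<le> Suc r" "z j = q h" and perm: "\<pi> permutes {1..n}"
  shows "key_tableau n lam \<pi> (j, i) = kth (key_set \<pi> h) i"
proof -
  let ?X = "\<lambda>h. sorted_list_of_set (key_set \<pi> h)"
  have q1: "1 \<le> q g" if "1 \<le> g" "g \<le> Suc r" for g
    using q_strict[of 0 g] that by simp
  \<comment> \<open>The leading \<open>lam n\<close> full columns are the block with index
    \<open>Suc r\<close>, since \<open>q (Suc r) = n\<close>.\<close>
  have last: "?X (Suc r) = [1..<n + 1]"
    using permutes_image[OF perm]
    by (simp add: sorted_list_of_set_range[symmetric] atLeastLessThanSuc_atLeastAtMost)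
  have anti: "lam (q (Suc g)) \<le> lam (q g)" if "1 \<le> g" "g \<le> r" for g
    using that q1 q_mono q_le_n by (intro lam_antimono) auto
  have "1 \<le> j"
    using assms by (simp add: mem_boxes)
  \<comment> \<open>This bound and the next place position \<open>j - 1\<close> inside the block of
    \<open>h\<close>.\<close>
  moreover have "j \<le> lam (q h)"
    using le_z_iff[of "q h" j] q1[of h] q_le_n[of h] assms by simp
  moreover have "lam (q (Suc h)) \<le> j - 1" if "h \<le> r"
  proof -
    have "\<not> q (Suc h) \<le> z j"
      using q_strict[of h "Suc h"] assms(4) that by simp
    then have "\<not> j \<le> lam (q (Suc h))"
      using le_z_iff[of "q (Suc h)" j] q1[of "Suc h"] q_le_n[of "Suc h"] that by simp
    then show ?thesis by simp
  qed
  ultimately have "(replicate (lam (q (Suc r))) (?X (Suc r)) @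
      concat (map (\<lambda>h. replicate (lam (q h) - lam (q (h + 1))) (?X h)) (rev [1..<Suc r]))) ! (j - 1) = ?X h"
    using nth_blocks[of r "\<lambda>h. lam (q h)" 1 ?X, OF anti] assms(2,3) by simp
  then have "key_columns n lam \<pi> ! (j - 1) = ?X h"
    unfolding key_columns_def last by simp
  then show ?thesis
    using assms(1) by (simp add: key_tableau_def kth_def)
qed

lemma card_key_set:
  assumes "\<pi> permutes {1..n}"
  shows "card (key_set \<pi> h) = q h"
  using permutes_inj_on[OF assms] by (simp add: card_image)

subsection \<open>Scanning\<close>

text \<open>
  The rows of column \<open>c\<close> that are still unmarked after \<open>k\<close> rounds are \<open>1, \<dots>, height T j k c\<close>:
  the earliest weakly increasing subsequence consists of the weak left-to-right maxima.
\<close>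

primrec height :: "tableau \<Rightarrow> nat \<Rightarrow> nat \<Rightarrow> nat \<Rightarrow> nat" where
  "height T j 0 c = z c"
| "height T j (Suc k) c =
    (if \<forall>c'. j \<le> c' \<and> c' < c \<and> 1 \<le> height T j k c' \<longrightarrow>
         T (c', height T j k c') \<le> T (c, height T j k c)
     then height T j k c - 1 else height T j k c)"

text \<open>Stated for an arbitrary profile \<open>L\<close> of remaining heights: marking only
  takes lowest boxes, so the unmarked boxes keep this form from round to round.\<close>

lemma set_scan_path:
  assumes "1 \<le> j" and M: "M = {(c, i). j \<le> c \<and> c \<le> lam 1 \<and> 1 \<le> i \<and> i \<le> L c}"
  shows "set (scan_path T M) = (\<lambda>c. (c, L c)) ` {c. j \<le> c \<and> c \<le> lam 1 \<and> 1 \<le> L c \<and>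
      (\<forall>c'. j \<le> c' \<and> c' < c \<and> 1 \<le> L c' \<longrightarrow> T (c', L c') \<le> T (c, L c))}"
    and "\<And>c. j \<le> c \<Longrightarrow> c \<le> lam 1 \<Longrightarrow> 1 \<le> L c \<Longrightarrow> T (c, L c) \<le> T (last (scan_path T M))"
    and "M \<noteq> {} \<Longrightarrow> \<exists>c. j \<le> c \<and> c \<le> lam 1 \<and> 1 \<le> L c \<and> last (scan_path T M) = (c, L c)"
proof -
  let ?C = "{c. j \<le> c \<and> c \<le> lam 1 \<and> 1 \<le> L c}"
  let ?cs = "sorted_list_of_set ?C"
  have fin: "finite ?C"
    by (rule finite_subset[of _ "{..lam 1}"]) auto
  have "fst ` M = ?C"
    unfolding M by force
  moreover have "Max {i. (c, i) \<in> M} = L c" if "c \<in> ?C" for c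
  proof (rule Max_eqI)
    show "finite {i. (c, i) \<in> M}"
      by (rule finite_subset[of _ "{..L c}"]) (auto simp: M)
  qed (use that in \<open>auto simp: M\<close>)
  ultimately have path: "scan_path T M = ewis T (map (\<lambda>c. (c, L c)) ?cs)"
    unfolding scan_path_def using fin by (intro arg_cong[of _ _ "ewis T"]) auto
  show eq: "set (scan_path T M) = (\<lambda>c. (c, L c)) ` {c. j \<le> c \<and> c \<le> lam 1 \<and> 1 \<le> L c \<and>
      (\<forall>c'. j \<le> c' \<and> c' < c \<and> 1 \<le> L c' \<longrightarrow> T (c', L c') \<le> T (c, L c))}"
    unfolding path using fin by (subst set_ewis) (auto intro!: image_eqI)
  show "T (c, L c) \<le> T (last (scan_path T M))" if "j \<le> c" "c \<le> lam 1" "1 \<le> L c" for c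
  proof -
    have mem: "(c, L c) \<in> set (map (\<lambda>c. (c, L c)) ?cs)"
      using that fin by auto
    then obtain x xs where "map (\<lambda>c. (c, L c)) ?cs = x # xs"
      by (cases "map (\<lambda>c. (c, L c)) ?cs") auto
    then show ?thesis
      using le_last_ewis[of "(c, L c)" x xs T] mem unfolding path by simp
  qed
  show "\<exists>c. j \<le> c \<and> c \<le> lam 1 \<and> 1 \<le> L c \<and> last (scan_path T M) = (c, L c)" if "M \<noteq> {}"
  proof -
    have "?C \<noteq> {}"
      using that \<open>fst ` M = ?C\<close> by blast
    then obtain x xs where "map (\<lambda>c. (c, L c)) ?cs = x # xs"
      using fin by (cases "map (\<lambda>c. (c, L c)) ?cs") auto
    then have "scan_path T M \<noteq> []"
      unfolding path by simp
    then have "last (scan_path T M) \<in> set (scan_path T M)"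
      by simp
    then show ?thesis
      unfolding eq by auto
  qed
qed

text \<open>For an exhausted column the comparison made by \<open>height\<close> is meaningless, but
  \<open>0 - 1 = 0\<close> keeps the column empty.\<close>

lemma unmarked_eq:
  assumes "1 \<le> j"
  shows "unmarked n lam T j k = {(c, i). j \<le> c \<and> c \<le> lam 1 \<and> 1 \<le> i \<and> i \<le> height T j k c}"
proof (induction k)
  case 0
  then show ?case
    using assms by (auto simp: mem_boxes)
next
  case (Suc k)
  show ?case
    unfolding unmarked.simps set_scan_path(1)[OF assms Suc]
    unfolding Suc by (auto simp: image_iff split: if_splits)
qed

text \<open>Column \<open>j\<close> is read first, so its lowest unmarked box is on every
  path.\<close>

lemma height_first: "k \<le> z j \<Longrightarrow> height T j k j = z j - k"
  by (induction k) auto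

text \<open>Together the two parts say that the scanning value is the largest of the lowest unmarked
  entries: the last weak left-to-right maximum is the overall maximum. From here on only
  \<open>height\<close> is needed and paths disappear.\<close>

lemma scan_box:
  fixes T :: tableau
  assumes "(j, i) \<in> bx"
  defines "L \<equiv> height T j (z j - i)"
  shows "\<And>c. j \<le> c \<Longrightarrow> c \<le> lam 1 \<Longrightarrow> 1 \<le> L c \<Longrightarrow> T (c, L c) \<le> scanning_tableau n lam T (j, i)"
    and "\<exists>c. j \<le> c \<and> c \<le> lam 1 \<and> 1 \<le> L c \<and> scanning_tableau n lam T (j, i) = T (c, L c)"
proof -
  have j: "1 \<le> j" "j \<le> lam 1"
    using assms by (auto simp: mem_boxes)
  have S: "scanning_tableau n lam T (j, i) = T (last (scan_path T (unmarked n lam T j (z j - i))))"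
    using assms(1) by (simp add: scanning_tableau_def)
  show "T (c, L c) \<le> scanning_tableau n lam T (j, i)"
    if "j \<le> c" "c \<le> lam 1" "1 \<le> L c" for c
    unfolding S L_def by (rule set_scan_path(2)[OF j(1) unmarked_eq[OF j(1)]])
      (use that in \<open>auto simp: L_def\<close>)
  have "L j = i"
    using height_first[of "z j - i" j T] assms by (auto simp: mem_boxes)
  then have "(j, i) \<in> unmarked n lam T j (z j - i)"
    using assms(1) j unfolding unmarked_eq[OF j(1)] L_def by (auto simp: mem_boxes)
  then have "unmarked n lam T j (z j - i) \<noteq> {}"
    by blast
  then show "\<exists>c. j \<le> c \<and> c \<le> lam 1 \<and> 1 \<le> L c \<and> scanning_tableau n lam T (j, i) = T (c, L c)"
    using set_scan_path(3)[OF j(1) unmarked_eq[OF j(1)], of T "z j - i" T] unfolding S L_def by auto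
qed

lemma tableau_le_scanning:
  assumes "(j, i) \<in> bx"
  shows "T (j, i) \<le> scanning_tableau n lam T (j, i)"
  using scan_box(1)[OF assms, of j T] height_first[of "z j - i" j T] assms by (auto simp: mem_boxes)

lemma height_le_z: "height T j k c \<le> z c"
  by (induction k) auto

text \<open>A column whose height attains the bound \<open>z j - k\<close> loses a box in this
  round: the lowest unmarked boxes to its left lie in the same row or above it, so their values are
  no larger.\<close>

lemma height_le:
  assumes "T \<in> tableaux n lam" "1 \<le> j" "j \<le> c" "c \<le> lam 1" "k \<le> z j"
  shows "height T j k c \<le> z j - k"
  using assms(3-)
proof (induction k arbitrary: c)
  case 0
  then show ?case
    using z_antimono by simp
next
  case (Suc k)
  show ?case
  proof (cases "height T j k c = z j - k")
    case True
    have box: "(c, z j - k) \<in> bx"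
      using Suc.prems height_le_z[of T j k c] True assms(2) by (auto simp: mem_boxes)
    have "T (c', height T j k c') \<le> T (c, height T j k c)"
      if "j \<le> c'" "c' < c" "1 \<le> height T j k c'" for c'
    proof -
      have box': "(c', z j - k) \<in> bx"
        using box that assms(2) z_antimono[of c' c] by (auto simp: mem_boxes)
      have "height T j k c' \<le> z j - k"
        using Suc that by simp
      then have "T (c', height T j k c') \<le> T (c', z j - k)"
        using tab_col[OF assms(1) box' that(3)] by simp
      also have "\<dots> \<le> T (c, z j - k)"
        using tab_row[OF assms(1) box, of c'] that assms(2) by simp
      finally show ?thesis
        using True by simp
    qed
    then show ?thesis
      using True by simp
  next
    case False
    then have "height T j k c \<le> z j - Suc k"
      using Suc.IH[of c] Suc.prems by simp
    then show ?thesis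
      using diff_le_self le_trans by auto
  qed
qed

text \<open>In the round for row \<open>Suc i\<close>, column \<open>c\<close> either lost a box,
  and the entry above it is strictly smaller, or it was passed over because of a strictly larger
  entry to its left. In both cases the larger entry took part in the maximum of that round.\<close>

lemma less_previous_scan:
  assumes "T \<in> tableaux n lam" "(j, Suc i) \<in> bx" "j \<le> c" "c \<le> lam 1" "1 \<le> height T j (z j - i) c"
  shows "T (c, height T j (z j - i) c) < scanning_tableau n lam T (j, Suc i)"
proof -
  define k where "k = z j - Suc i"
  have k: "z j - i = Suc k"
    using assms(2) by (auto simp: mem_boxes k_def)
  let ?L = "height T j k"
  note S = scan_box(1)[OF assms(2), of _ T, folded k_def]
  show ?thesis
  proof (cases "\<forall>c'. j \<le> c' \<and> c' < c \<and> 1 \<le> ?L c' \<longrightarrow> T (c', ?L c') \<le> T (c, ?L c)")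
    case True
    then have h: "height T j (Suc k) c = ?L c - 1"
      by simp
    have "1 \<le> j"
      using assms(2) by (simp add: mem_boxes)
    then have "(c, ?L c) \<in> bx"
      using assms(3-5) height_le_z[of T j k c] h k by (simp add: mem_boxes)
    then have "T (c, ?L c - 1) + (?L c - (?L c - 1)) \<le> T (c, ?L c)"
      using assms(5) h k by (intro tab_col[OF assms(1)]) auto
    moreover have "2 \<le> ?L c"
      using assms(5) h k by simp
    ultimately have "T (c, ?L c - 1) < T (c, ?L c)"
      by linarith
    also have "\<dots> \<le> scanning_tableau n lam T (j, Suc i)"
      using S assms \<open>2 \<le> ?L c\<close> by simp
    finally show ?thesis
      using h k by simp
  next
    case False
    then have h: "height T j (Suc k) c = ?L c"
      by (simp only: height.simps if_False)
    obtain c' where "j \<le> c'" "c' < c" "1 \<le> ?L c'" "T (c, ?L c) < T (c', ?L c')"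
      using False by (auto simp: not_le)
    then have "T (c, ?L c) < scanning_tableau n lam T (j, Suc i)"
      using S[of c'] assms(4) by linarith
    then show ?thesis
      using h k by simp
  qed
qed

subsection \<open>Demazure sets of 312-avoiding permutations\<close>

lemma permD: "\<pi> \<in> S_perms n lam \<Longrightarrow> \<pi> permutes {1..n}"
  by (simp add: S_perms_def)

lemma S312D: "\<pi> \<in> S312_perms n lam \<Longrightarrow> \<pi> \<in> S_perms n lam"
  by (simp add: S312_perms_def)

lemma key_set_mono: "g \<le> h \<Longrightarrow> h \<le> Suc r \<Longrightarrow> key_set \<pi> g \<subseteq> key_set \<pi> h"
  using q_mono[of g h] by auto

lemma key_set_subset:
  assumes "\<pi> permutes {1..n}" "h \<le> Suc r"
  shows "key_set \<pi> h \<subseteq> {1..n}"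
  using key_set_mono[of h "Suc r" \<pi>] permutes_image[OF assms(1)] assms(2) by simp

text \<open>Keys see a permutation only through its key sets, so the pattern is expressed by them.
  Admitting \<open>h = r\<close> is harmless, since nothing lies outside
  \<open>key_set \<pi> (Suc r)\<close>.\<close>

lemma contains_312_iff:
  assumes perm: "\<pi> permutes {1..n}"
  shows "contains_312 n lam \<pi> \<longleftrightarrow> (\<exists>h a b c. 1 \<le> h \<and> h \<le> r \<and>
    a \<in> key_set \<pi> h \<and> b \<in> key_set \<pi> (Suc h) - key_set \<pi> h \<and> c \<in> {1..n} - key_set \<pi> (Suc h) \<and> b < c \<and> c < a)"
    (is "_ \<longleftrightarrow> (\<exists>h a b c. ?P h a b c)")
proof
  have inj: "\<pi> x = \<pi> y \<longleftrightarrow> x = y" for x y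
    using permutes_inj[OF perm] by (auto dest: injD)
  have notin: "\<pi> x \<notin> key_set \<pi> h" if "q h < x" for x h
    using that by (auto simp: inj)
  assume "contains_312 n lam \<pi>"
  then obtain h a b c where *: "1 \<le> h" "h \<le> r - 1" "1 \<le> a" "a \<le> q h" "q h < b" "b \<le> q (h + 1)"
      "q (h + 1) < c" "c \<le> n" "\<pi> b < \<pi> c" "\<pi> c < \<pi> a"
    unfolding contains_312_def by auto
  have "?P h (\<pi> a) (\<pi> b) (\<pi> c)"
  proof (intro conjI)
    show "\<pi> b \<in> key_set \<pi> (Suc h) - key_set \<pi> h"
      using notin * by auto
    have "\<pi> c \<in> {1..n}"
      using permutes_in_image[OF perm, of c] * by auto
    then show "\<pi> c \<in> {1..n} - key_set \<pi> (Suc h)"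
      using notin[of "Suc h" c] * by simp
  qed (use * in auto)
  then show "\<exists>h a b c. ?P h a b c" by blast
next
  assume "\<exists>h a b c. ?P h a b c"
  then obtain h a b c where *: "?P h a b c" by blast
  from * obtain a' where a': "a = \<pi> a'" "1 \<le> a'" "a' \<le> q h" by auto
  from * obtain b' where b': "b = \<pi> b'" "1 \<le> b'" "b' \<le> q (Suc h)" by auto
  have "q h < b'"
    using * b' by (metis DiffE atLeastAtMost_iff imageI not_le)
  from * have "c \<in> \<pi> ` {1..n}"
    using permutes_image[OF perm] by blast
  then obtain c' where c': "c = \<pi> c'" "1 \<le> c'" "c' \<le> n" by auto
  have "q (Suc h) < c'"
    using * c' by (metis DiffE atLeastAtMost_iff imageI not_le)
  then have "h \<noteq> r"
    using c' q_last by force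
  then have "h \<in> {1..r - 1}"
    using * by auto
  then show "contains_312 n lam \<pi>"
    unfolding contains_312_def
    using * a' b' c' \<open>q h < b'\<close> \<open>q (Suc h) < c'\<close> by (intro bexI exI conjI) auto
qed

text \<open>Otherwise \<open>a\<close>, \<open>b\<close>, \<open>y\<close> would play the roles of
  3, 1 and 2.\<close>

lemma S312_step:
  assumes "\<pi> \<in> S312_perms n lam" "1 \<le> h" "h \<le> r"
    "b \<in> key_set \<pi> (Suc h) - key_set \<pi> h" "a \<in> key_set \<pi> h" "b \<le> y" "y \<le> a"
  shows "y \<in> key_set \<pi> (Suc h)"
proof (rule ccontr)
  assume y: "y \<notin> key_set \<pi> (Suc h)"
  have perm: "\<pi> permutes {1..n}"
    using assms(1) permD S312D by blast
  have "y \<noteq> b" "y \<noteq> a"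
    using y assms(4,5) key_set_mono[of h "Suc h" \<pi>] assms(3) by auto
  moreover have "y \<in> {1..n}"
    using key_set_subset[OF perm, of "Suc h"] key_set_subset[OF perm, of h] assms(3-7)
    by (meson DiffD1 Suc_le_mono atLeastAtMost_iff le_SucI order_trans subsetD)
  ultimately have "y \<in> {1..n} - key_set \<pi> (Suc h)" "b < y" "y < a"
    using assms(6,7) y by (simp_all only: Diff_iff) simp_all
  then have "contains_312 n lam \<pi>"
    unfolding contains_312_iff[OF perm] using assms(2-5) by blast
  then show False
    using assms(1) by (simp add: S312_perms_def)
qed

text \<open>The one-step version applies at the moment when \<open>b\<close> enters; after that the
  key sets only grow.\<close>

lemma S312_interval:
  assumes "\<pi> \<in> S312_perms n lam" "1 \<le> g" "g \<le> h" "h \<le> Suc r"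
    "b \<in> key_set \<pi> h - key_set \<pi> g" "a \<in> key_set \<pi> g" "b \<le> y" "y \<le> a"
  shows "y \<in> key_set \<pi> h"
  using assms(3-5)
proof (induction rule: dec_induct)
  case (step m)
  show ?case
  proof (cases "b \<in> key_set \<pi> m")
    case True
    then have "y \<in> key_set \<pi> m"
      using step by auto
    then show ?thesis
      using key_set_mono[of m "Suc m" \<pi>] step.prems by (meson le_SucI order_refl subsetD)
  next
    case False
    have "a \<in> key_set \<pi> m"
      using key_set_mono[of g m \<pi>] step assms(6) by (meson Suc_leD subsetD)
    then show ?thesis
      using S312_step[OF assms(1), of m b a y] step False assms by auto
  qed
qed auto

text \<open>The key set has \<open>q (Suc h)\<close> elements, so rank
  \<open>q (Suc h) - i + 1\<close> from above is rank \<open>i\<close> from below.\<close>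

lemma Psi_eq:
  assumes "\<pi> permutes {1..n}" "h \<le> r" "q h < i" "i \<le> q (Suc h)"
  shows "Psi n lam \<pi> i = kth (key_set \<pi> (Suc h)) i"
proof -
  have "i \<in> {1..n}"
    using assms q_le_n[of "Suc h"] by auto
  then show ?thesis
    unfolding Psi_def using carrel_index_eq[OF assms(2-4)] assms card_key_set[OF assms(1), of "Suc h"]
    by (simp add: rank_desc_eq_kth)
qed

lemma demazure_subset:
  assumes perm: "\<pi> permutes {1..n}"
  shows "demazure_set n lam \<pi> \<subseteq> row_bound_set n lam (Psi n lam \<pi>)"
proof
  fix T assume T: "T \<in> demazure_set n lam \<pi>"
  then have tab: "T \<in> tableaux n lam"
    by (simp add: demazure_set_def)
  have le: "T (j, i) \<le> key_tableau n lam \<pi> (j, i)" if "(j, i) \<in> bx" for j i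
    using tableau_le_scanning[OF that, of T] T that unfolding demazure_set_def
    by (auto intro: order_trans)
  have "T (j, i) \<le> Psi n lam \<pi> i" if box: "(j, i) \<in> bx" for j i
  proof -
    have i: "1 \<le> i" "i \<le> n" "1 \<le> j" "j \<le> lam 1"
      using box z_le_n[of j] by (auto simp: mem_boxes)
    obtain h where h: "h \<le> r" "q h < i" "i \<le> q (Suc h)"
      using carrel_ex[OF i(1,2)] .
    have ge: "q (Suc h) \<le> z j"
      using carrel_end_le_z[OF box h(1,2)] .
    \<comment> \<open>The bound on row \<open>i\<close> is a key entry in columns ending with the
      carrel of \<open>i\<close>, so the entry is moved right along its row to such a column. In the
      last carrel column \<open>j\<close> itself has length \<open>n\<close>.\<close>
    obtain j' where j': "j \<le> j'" "j' \<le> lam 1" "z j' = q (Suc h)"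
    proof (cases "h = r")
      case True
      then show ?thesis
        using that[of j] ge z_le_n[of j] i by simp
    next
      case False
      then obtain j' where j': "1 \<le> j'" "j' \<le> lam 1" "z j' = q (Suc h)"
        using column_of_length_q[of "Suc h"] h by auto
      show ?thesis
      proof (cases "j \<le> j'")
        case True
        then show ?thesis using that j' by blast
      next
        case False
        then have "z j = q (Suc h)"
          using z_antimono[of j' j] ge j' by simp
        then show ?thesis using that[of j] i by simp
      qed
    qed
    have box': "(j', i) \<in> bx"
      using j' i h by (auto simp: mem_boxes)
    have "T (j, i) \<le> T (j', i)"
      using tab_row[OF tab box'] i j' by simp
    also have "\<dots> \<le> kth (key_set \<pi> (Suc h)) i"
      using le[OF box'] key_tableau_eq[OF box' _ _ j'(3) perm] h by simp
    finally show ?thesis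
      using Psi_eq[OF perm h] by simp
  qed
  then show "T \<in> row_bound_set n lam (Psi n lam \<pi>)"
    using tab by (auto simp: row_bound_set_def)
qed

text \<open>Enlarging a set can only lower its \<open>i\<close>-th smallest element; hence the rows
  of a key increase weakly.\<close>

lemma key_set_superset_below:
  assumes "\<pi> permutes {1..n}" "1 \<le> g" "g \<le> h" "h \<le> Suc r" "1 \<le> i" "i \<le> q g"
  shows "kth (key_set \<pi> h) i \<le> kth (key_set \<pi> g) i"
proof -
  let ?x = "kth (key_set \<pi> h) i"
  have "q g \<le> q h"
    using q_mono assms by simp
  have "card {y \<in> key_set \<pi> g. y < ?x} \<le> card {y \<in> key_set \<pi> h. y < ?x}"
    using key_set_mono[OF assms(3,4), of \<pi>] by (intro card_mono) auto
  also have "\<dots> = i - 1"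
    using card_key_set[OF assms(1), of h] assms \<open>q g \<le> q h\<close> by (intro card_less_kth) auto
  finally show ?thesis
    using le_kth_iff[of "key_set \<pi> g" i ?x] card_key_set[OF assms(1), of g] assms by simp
qed

text \<open>The induction goes up the column. If the key set of the carrel of \<open>i\<close> and
  \<open>key_set \<pi> h\<close> agree below the entry, its row bound transfers by counting.
  Otherwise avoidance puts the entry into \<open>key_set \<pi> h\<close>, and being strictly smaller
  than the entry beneath it brings it under the bound.\<close>

lemma row_bound_imp_le_key:
  assumes T: "T \<in> row_bound_set n lam (Psi n lam \<pi>)" and \<pi>: "\<pi> \<in> S312_perms n lam"
    and box: "(j, i) \<in> bx" and h: "1 \<le> h" "h \<le> Suc r" "z j = q h"
  shows "T (j, i) \<le> kth (key_set \<pi> h) i"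
proof -
  have perm: "\<pi> permutes {1..n}"
    using \<pi> permD S312D by blast
  have tab: "T \<in> tableaux n lam"
    using T by (simp add: row_bound_set_def)
  have bound: "T (j, i) \<le> Psi n lam \<pi> i" if "(j, i) \<in> bx" for i
    using T that by (auto simp: row_bound_set_def)
  have cardh: "card (key_set \<pi> h) = q h"
    using card_key_set[OF perm] .
  have ih: "1 \<le> i" "i \<le> q h"
    using box h by (auto simp: mem_boxes)
  show ?thesis
    using ih(2,1)
  proof (induction rule: inc_induct)
    case base
    obtain h' where h': "h = Suc h'"
      using h by (cases h) auto
    then have "q h' < q h"
      using q_strict[of h' h] h by simp
    then have "Psi n lam \<pi> (q h) = kth (key_set \<pi> h) (q h)"
      using Psi_eq[OF perm, of h' "q h"] h h' by simp
    moreover have "(j, q h) \<in> bx"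
      using box h base by (auto simp: mem_boxes)
    ultimately show ?case
      using bound[of "q h"] by simp
  next
    case (step i)
    have box_i: "(j, i) \<in> bx"
      using box h step by (auto simp: mem_boxes)
    have i: "1 \<le> i" "i \<le> n"
      using step q_le_n[of h] h by auto
    obtain g where g: "g \<le> r" "q g < i" "i \<le> q (Suc g)"
      using carrel_ex[OF i] .
    have "q g < q h"
      using g step by simp
    then have gh: "Suc g \<le> h"
      using q_less_imp[of g h] g by simp
    let ?t = "T (j, i)"
    have t: "?t \<le> kth (key_set \<pi> (Suc g)) i"
      using bound[OF box_i] Psi_eq[OF perm g] by simp
    have cardg: "card (key_set \<pi> (Suc g)) = q (Suc g)"
      using card_key_set[OF perm] .
    show ?case
    proof (cases "\<exists>b \<in> key_set \<pi> h - key_set \<pi> (Suc g). b < ?t")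
      case True
      then obtain b where b: "b \<in> key_set \<pi> h - key_set \<pi> (Suc g)" "b < ?t" by blast
      have "kth (key_set \<pi> (Suc g)) i \<in> key_set \<pi> (Suc g)"
        using kth_in[of "key_set \<pi> (Suc g)" i] cardg g i by simp
      then have "?t \<in> key_set \<pi> h"
        using S312_interval[OF \<pi> _ gh h(2) b(1) _ _ t] b(2) by simp
      moreover have "?t < T (j, Suc i)"
        using tab_col[OF tab, of j "Suc i" i] step box h by (auto simp: mem_boxes)
      ultimately show ?thesis
        using step cardh i by (intro le_kth_of_less) auto
    next
      case False
      then have eq: "{y \<in> key_set \<pi> h. y < ?t} = {y \<in> key_set \<pi> (Suc g). y < ?t}"
        using key_set_mono[OF gh h(2), of \<pi>] by blast
      show ?thesis
        using le_kth_iff[of "key_set \<pi> h" i ?t] le_kth_iff[of "key_set \<pi> (Suc g)" i ?t] t eq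
          cardg cardh i g step by simp
    qed
  qed
qed

text \<open>
  The scanning value in row \<open>i\<close> is smaller than the one in the row below. Hence, going up the rows,
  it stays below the \<open>i\<close>-th smallest element of \<open>B\<close> whenever it lies in \<open>B\<close>.
\<close>

lemma scanning_le_kth:
  assumes tab: "T \<in> tableaux n lam" and B: "finite B" "card B = z j" and box: "(j, i) \<in> bx"
    and cases: "\<And>i c m. j \<le> c \<Longrightarrow> (c, m) \<in> bx \<Longrightarrow> m \<le> i \<Longrightarrow> i \<le> z j \<Longrightarrow>
      T (c, m) \<in> B \<or> T (c, m) \<le> kth B i"
  shows "scanning_tableau n lam T (j, i) \<le> kth B i"
proof -
  have ij: "1 \<le> i" "i \<le> z j" "1 \<le> j"
    using box by (auto simp: mem_boxes)
  have main: "scanning_tableau n lam T (j, i) \<le> kth B i"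
    if i: "1 \<le> i" "i \<le> z j"
      and prev: "i < z j \<Longrightarrow> scanning_tableau n lam T (j, Suc i) \<le> kth B (Suc i)" for i
  proof -
    have box_i: "(j, i) \<in> bx"
      using i box by (auto simp: mem_boxes)
    let ?L = "height T j (z j - i)"
    obtain c where c: "j \<le> c" "c \<le> lam 1" "1 \<le> ?L c"
        and scan: "scanning_tableau n lam T (j, i) = T (c, ?L c)"
      using scan_box(2)[OF box_i, of T] by blast
    have "(c, ?L c) \<in> bx"
      using c ij height_le_z[of T j "z j - i" c] by (auto simp: mem_boxes)
    moreover have "?L c \<le> i"
      using height_le[OF tab ij(3) c(1,2), of "z j - i"] i by simp
    ultimately consider "T (c, ?L c) \<in> B" | "T (c, ?L c) \<le> kth B i"
      using cases[OF c(1)] i by blast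
    then have "T (c, ?L c) \<le> kth B i"
    proof cases
      case mem: 1
      show ?thesis
      proof (cases "i = z j")
        case True
        then show ?thesis
          using kth_card_eq_Max[of B] mem B Max_ge by (metis empty_iff)
      next
        case False
        then have "T (c, ?L c) < scanning_tableau n lam T (j, Suc i)"
          using i ij c box by (intro less_previous_scan[OF tab]) (auto simp: mem_boxes)
        then show ?thesis
          using prev False mem B i by (intro le_kth_of_less) auto
      qed
    qed
    then show ?thesis
      using scan by simp
  qed
  show ?thesis
    using ij(2,1)
  proof (induction rule: inc_induct)
    case base
    show ?case by (rule main) (use base in auto)
  next
    case (step i)
    show ?case by (rule main) (use step in auto)
  qed
qed

lemma later_column_length:
  assumes "1 \<le> j" "j \<le> c" "c \<le> lam 1" "h \<le> Suc r" "z j = q h"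
  obtains g where "1 \<le> g" "g \<le> h" "z c = q g"
proof -
  obtain g where g: "1 \<le> g" "g \<le> Suc r" "z c = q g"
    using z_eq_q[of c] assms by auto
  have "q g \<le> q h"
    using z_antimono[OF assms(2)] g assms by simp
  then have "g \<le> h"
    using q_strict[of h g] g by (meson leD leI)
  then show ?thesis
    using that g by blast
qed

text \<open>
  An entry \<open>t\<close> of a later column, of length \<open>q g\<close>: if some element of the \<open>h\<close>-th key column below
  \<open>t\<close> is missing from the \<open>g\<close>-th one, then 312-avoidance puts \<open>t\<close> in the \<open>h\<close>-th key column;
  otherwise the two key columns agree below \<open>t\<close>.
\<close>

lemma scanning_le_key:
  assumes T: "T \<in> row_bound_set n lam (Psi n lam \<pi>)" and \<pi>: "\<pi> \<in> S312_perms n lam"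
    and box: "(j, i) \<in> bx" and h: "1 \<le> h" "h \<le> Suc r" "z j = q h"
  shows "scanning_tableau n lam T (j, i) \<le> kth (key_set \<pi> h) i"
proof (rule scanning_le_kth)
  have perm: "\<pi> permutes {1..n}"
    using \<pi> permD S312D by blast
  show "T \<in> tableaux n lam"
    using T by (simp add: row_bound_set_def)
  show cardh: "card (key_set \<pi> h) = z j"
    using card_key_set[OF perm] h by simp
  fix i c m assume c: "j \<le> c" "(c, m) \<in> bx" "m \<le> i" "i \<le> z j"
  have j: "1 \<le> j" "c \<le> lam 1" "1 \<le> m"
    using box c by (auto simp: mem_boxes)
  obtain g where g: "1 \<le> g" "g \<le> h" "z c = q g"
    using later_column_length[OF j(1) c(1) j(2) h(2,3)] .
  have m: "m \<le> q g"
    using c g by (simp add: mem_boxes)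
  let ?t = "T (c, m)"
  have t: "?t \<le> kth (key_set \<pi> g) m"
    using row_bound_imp_le_key[OF T \<pi> c(2) g(1) _ g(3)] g h by simp
  have cardg: "card (key_set \<pi> g) = q g"
    using card_key_set[OF perm] .
  show "?t \<in> key_set \<pi> h \<or> ?t \<le> kth (key_set \<pi> h) i"
  proof (cases "\<exists>b \<in> key_set \<pi> h - key_set \<pi> g. b < ?t")
    case True
    then obtain b where b: "b \<in> key_set \<pi> h - key_set \<pi> g" "b < ?t" by blast
    have "kth (key_set \<pi> g) m \<in> key_set \<pi> g"
      using kth_in[of "key_set \<pi> g" m] cardg j m by simp
    then show ?thesis
      using S312_interval[OF \<pi> g(1,2) h(2) b(1) _ _ t] b(2) by simp
  next
    case False
    then have eq: "{y \<in> key_set \<pi> h. y < ?t} = {y \<in> key_set \<pi> g. y < ?t}"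
      using key_set_mono[OF g(2) h(2), of \<pi>] by blast
    have "card {y \<in> key_set \<pi> g. y < ?t} < m"
      using le_kth_iff[of "key_set \<pi> g" m ?t] t cardg j m by simp
    then show ?thesis
      using le_kth_iff[of "key_set \<pi> h" i ?t] eq cardh c j by simp
  qed
qed (use box in auto)

lemma demazure_eq_row_bound:
  assumes \<pi>: "\<pi> \<in> S312_perms n lam"
  shows "demazure_set n lam \<pi> = row_bound_set n lam (Psi n lam \<pi>)"
proof
  have perm: "\<pi> permutes {1..n}"
    using \<pi> permD S312D by blast
  show "demazure_set n lam \<pi> \<subseteq> row_bound_set n lam (Psi n lam \<pi>)"
    using demazure_subset[OF perm] .
  show "row_bound_set n lam (Psi n lam \<pi>) \<subseteq> demazure_set n lam \<pi>"
  proof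
    fix T assume T: "T \<in> row_bound_set n lam (Psi n lam \<pi>)"
    have "scanning_tableau n lam T (j, i) \<le> key_tableau n lam \<pi> (j, i)" if box: "(j, i) \<in> bx" for j i
    proof -
      obtain h where h: "1 \<le> h" "h \<le> Suc r" "z j = q h"
        using z_eq_q[of j] box by (auto simp: mem_boxes)
      then show ?thesis
        using scanning_le_key[OF T \<pi> box h] key_tableau_eq[OF box h perm] by simp
    qed
    then show "T \<in> demazure_set n lam \<pi>"
      using T by (auto simp: demazure_set_def row_bound_set_def)
  qed
qed

subsection \<open>Injectivity of the Demazure sets\<close>

lemma key_tableau_in_tableaux:
  assumes perm: "\<pi> permutes {1..n}"
  shows "key_tableau n lam \<pi> \<in> tableaux n lam"
proof -
  let ?Y = "key_tableau n lam \<pi>"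
  have "?Y (j, i) \<in> {1..n}" if box: "(j, i) \<in> bx" for j i
  proof -
    obtain h where h: "1 \<le> h" "h \<le> Suc r" "z j = q h"
      using z_eq_q[of j] box by (auto simp: mem_boxes)
    have "kth (key_set \<pi> h) i \<in> key_set \<pi> h"
      using card_key_set[OF perm, of h] box h by (intro kth_in) (auto simp: mem_boxes)
    then show ?thesis
      using key_tableau_eq[OF box h perm] key_set_subset[OF perm h(2)] by auto
  qed
  moreover have "?Y \<in> extensional bx"
    by (simp add: key_tableau_def)
  moreover have "?Y (j, i) < ?Y (j, i')" if box: "(j, i) \<in> bx" "(j, i') \<in> bx" "i < i'" for j i i'
  proof -
    obtain h where h: "1 \<le> h" "h \<le> Suc r" "z j = q h"
      using z_eq_q[of j] box by (auto simp: mem_boxes)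
    have "kth (key_set \<pi> h) i < kth (key_set \<pi> h) i'"
      using card_key_set[OF perm, of h] box h by (intro kth_strict) (auto simp: mem_boxes)
    then show ?thesis
      using key_tableau_eq[OF box(1) h perm] key_tableau_eq[OF box(2) h perm] by simp
  qed
  moreover have "?Y (j, i) \<le> ?Y (j', i)" if box: "(j, i) \<in> bx" "(j', i) \<in> bx" "j < j'" for j j' i
  proof -
    obtain h where h: "1 \<le> h" "h \<le> Suc r" "z j = q h"
      using z_eq_q[of j] box by (auto simp: mem_boxes)
    obtain g where g: "1 \<le> g" "g \<le> h" "z j' = q g"
      using later_column_length[of j j' h] box h by (auto simp: mem_boxes)
    have "1 \<le> i" "i \<le> q g"
      using box g by (auto simp: mem_boxes)
    then show ?thesis
      using key_tableau_eq[OF box(1) h perm] key_tableau_eq[OF box(2) g(1) _ g(3) perm]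
        key_set_superset_below[OF perm g(1,2) h(2)] g h by simp
  qed
  ultimately show ?thesis
    unfolding tableaux_def by (auto simp: PiE_def)
qed

text \<open>Key sets are nested, so every entry scanned for a column already lies in the key set of
  that column. With \<open>T \<le> S(T)\<close> this allows inclusions between Demazure sets to be
  tested on keys.\<close>

lemma key_in_demazure:
  assumes perm: "\<pi> permutes {1..n}"
  shows "key_tableau n lam \<pi> \<in> demazure_set n lam \<pi>"
proof -
  let ?Y = "key_tableau n lam \<pi>"
  note tab = key_tableau_in_tableaux[OF perm]
  have "scanning_tableau n lam ?Y (j, i) \<le> ?Y (j, i)" if box: "(j, i) \<in> bx" for j i
  proof -
    obtain h where h: "1 \<le> h" "h \<le> Suc r" "z j = q h"
      using z_eq_q[of j] box by (auto simp: mem_boxes)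
    have "scanning_tableau n lam ?Y (j, i) \<le> kth (key_set \<pi> h) i"
    proof (rule scanning_le_kth[OF tab _ _ box])
      show "card (key_set \<pi> h) = z j"
        using card_key_set[OF perm] h by simp
      fix i c m assume c: "j \<le> c" "(c, m) \<in> bx"
      have j: "1 \<le> j" "c \<le> lam 1" "1 \<le> m" "m \<le> z c"
        using box c by (auto simp: mem_boxes)
      obtain g where g: "1 \<le> g" "g \<le> h" "z c = q g"
        using later_column_length[OF j(1) c(1) j(2) h(2,3)] .
      have "kth (key_set \<pi> g) m \<in> key_set \<pi> g"
        using card_key_set[OF perm, of g] j g by (intro kth_in) auto
      then have "?Y (c, m) \<in> key_set \<pi> h"
        using key_tableau_eq[OF c(2) g(1) _ g(3) perm] key_set_mono[OF g(2) h(2), of \<pi>] g h by auto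
      then show "?Y (c, m) \<in> key_set \<pi> h \<or> ?Y (c, m) \<le> kth (key_set \<pi> h) i" ..
    qed auto
    then show ?thesis
      using key_tableau_eq[OF box h perm] by simp
  qed
  then show ?thesis
    using tab by (auto simp: demazure_set_def)
qed

lemma demazure_subset_imp_key_le:
  assumes "\<pi> permutes {1..n}" "demazure_set n lam \<pi> \<subseteq> demazure_set n lam \<rho>" "(j, i) \<in> bx"
  shows "key_tableau n lam \<pi> (j, i) \<le> key_tableau n lam \<rho> (j, i)"
proof -
  have "key_tableau n lam \<pi> \<in> demazure_set n lam \<rho>"
    using key_in_demazure[OF assms(1)] assms(2) by blast
  then have "scanning_tableau n lam (key_tableau n lam \<pi>) (j, i) \<le> key_tableau n lam \<rho> (j, i)"
    using assms(3) by (auto simp: demazure_set_def)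
  then show ?thesis
    using tableau_le_scanning[OF assms(3)] order_trans by blast
qed

text \<open>On each carrel the permutation lists, in increasing order, the elements by which its key
  set grows there.\<close>

lemma S_perms_eqI:
  assumes \<pi>: "\<pi> \<in> S_perms n lam" and \<rho>: "\<rho> \<in> S_perms n lam"
    and eq: "\<And>h. 1 \<le> h \<Longrightarrow> h \<le> r \<Longrightarrow> key_set \<pi> h = key_set \<rho> h"
  shows "\<pi> = \<rho>"
proof
  have perm: "\<pi> permutes {1..n}" "\<rho> permutes {1..n}"
    using \<pi> \<rho> permD by auto
  have eq': "key_set \<pi> h = key_set \<rho> h" if "h \<le> Suc r" for h
    using eq[of h] that permutes_image[OF perm(1)] permutes_image[OF perm(2)]
    by (cases "h = 0"; cases "h = Suc r") auto
  have rep: "\<sigma> i = kth (key_set \<sigma> (Suc h) - key_set \<sigma> h) (i - q h)"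
    if \<sigma>: "\<sigma> \<in> S_perms n lam" and h: "h \<le> r" "q h < i" "i \<le> q (Suc h)" for \<sigma> h i
  proof -
    have inj: "inj \<sigma>"
      using permutes_inj[OF permD[OF \<sigma>]] .
    have "strict_mono_on (carrel n lam (Suc h)) \<sigma>"
      using \<sigma> h(1) by (auto simp: S_perms_def carrel_increasing_def)
    then have mono: "\<sigma> x < \<sigma> y" if "q h < x" "x < y" "y \<le> q (Suc h)" for x y
      using that by (auto simp: carrel_Suc strict_mono_on_def)
    have "{1..q (Suc h)} - {1..q h} = {q h<..q (Suc h)}" by auto
    then have diff: "key_set \<sigma> (Suc h) - key_set \<sigma> h = \<sigma> ` {q h<..q (Suc h)}"
      using image_set_diff[OF inj, of "{1..q (Suc h)}" "{1..q h}"] by simp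
    have "kth (\<sigma> ` {q h<..q (Suc h)}) (i - q h) = \<sigma> i"
    proof (rule kth_eqI)
      have "\<sigma> y < \<sigma> i \<longleftrightarrow> y < i" if "q h < y" "y \<le> q (Suc h)" for y
        using mono[of y i] mono[of i y] that h by (cases y i rule: linorder_cases) auto
      then have "{y \<in> \<sigma> ` {q h<..q (Suc h)}. y < \<sigma> i} = \<sigma> ` {q h<..<i}"
        using h by auto
      then show "card {y \<in> \<sigma> ` {q h<..q (Suc h)}. y < \<sigma> i} = i - q h - 1"
        using inj by (simp add: card_image inj_on_subset)
    qed (use h in auto)
    then show ?thesis
      unfolding diff by simp
  qed
  fix i
  show "\<pi> i = \<rho> i"
  proof (cases "i \<in> {1..n}")
    case True
    then obtain h where h: "h \<le> r" "q h < i" "i \<le> q (Suc h)"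
      using carrel_ex[of i] by auto
    then show ?thesis
      using rep[OF \<pi> h] rep[OF \<rho> h] eq'[of h] eq'[of "Suc h"] by simp
  next
    case False
    then show ?thesis
      using perm by (simp add: permutes_not_in)
  qed
qed

lemma demazure_inj:
  assumes \<pi>: "\<pi> \<in> S_perms n lam" and \<rho>: "\<rho> \<in> S_perms n lam"
    and eq: "demazure_set n lam \<pi> = demazure_set n lam \<rho>"
  shows "\<pi> = \<rho>"
proof (rule S_perms_eqI[OF \<pi> \<rho>])
  fix h assume h: "1 \<le> h" "h \<le> r"
  have perm: "\<pi> permutes {1..n}" "\<rho> permutes {1..n}"
    using \<pi> \<rho> permD by auto
  obtain j where j: "1 \<le> j" "j \<le> lam 1" "z j = q h"
    using column_of_length_q[OF h] .
  have kth: "kth (key_set \<pi> h) i = kth (key_set \<rho> h) i" if "1 \<le> i" "i \<le> q h" for i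
  proof -
    have box: "(j, i) \<in> bx"
      using that j by (simp add: mem_boxes)
    have "key_tableau n lam \<pi> (j, i) = key_tableau n lam \<rho> (j, i)"
      using demazure_subset_imp_key_le[OF perm(1) _ box, of \<rho>]
        demazure_subset_imp_key_le[OF perm(2) _ box, of \<pi>] eq by (simp add: le_antisym)
    then show ?thesis
      using key_tableau_eq[OF box h(1) _ j(3)] perm h by simp
  qed
  have sub: "key_set \<sigma> h \<subseteq> kth (key_set \<sigma> h) ` {1..q h}" if "\<sigma> permutes {1..n}" for \<sigma>
    using kth_surj[of "key_set \<sigma> h"] card_key_set[OF that, of h]
    by (metis atLeastAtMost_iff finite_atLeastAtMost finite_imageI image_eqI subsetI)
  have sup: "kth (key_set \<sigma> h) ` {1..q h} \<subseteq> key_set \<sigma> h" if "\<sigma> permutes {1..n}" for \<sigma>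
    using kth_in[of "key_set \<sigma> h"] card_key_set[OF that, of h] by auto
  have "key_set \<pi> h = kth (key_set \<pi> h) ` {1..q h}"
    using sub[OF perm(1)] sup[OF perm(1)] by (rule equalityI)
  also have "\<dots> = kth (key_set \<rho> h) ` {1..q h}"
    using kth by (intro image_cong) auto
  also have "\<dots> = key_set \<rho> h"
    using sup[OF perm(2)] sub[OF perm(2)] by (rule equalityI)
  finally show "key_set \<pi> h = key_set \<rho> h" .
qed

subsection \<open>Gapless tuples from 312-avoiding permutations\<close>

lemma carrel_increasing_iff:
  "carrel_increasing n lam f \<longleftrightarrow>
    (\<forall>h i k. h \<le> r \<longrightarrow> q h < i \<longrightarrow> i < k \<longrightarrow> k \<le> q (Suc h) \<longrightarrow> f i < f k)"
proof
  assume inc: "carrel_increasing n lam f"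
  show "\<forall>h i k. h \<le> r \<longrightarrow> q h < i \<longrightarrow> i < k \<longrightarrow> k \<le> q (Suc h) \<longrightarrow> f i < f k"
  proof (intro allI impI)
    fix h i k assume hyps: "h \<le> r" "q h < i" "i < k" "k \<le> q (Suc h)"
    have "Suc h \<in> {1..r + 1}"
      using hyps by simp
    then have "strict_mono_on {q h<..q (Suc h)} f"
      using inc unfolding carrel_increasing_def carrel_Suc[symmetric] by blast
    then show "f i < f k"
      using hyps by (auto simp: strict_mono_on_def)
  qed
next
  assume inc: "\<forall>h i k. h \<le> r \<longrightarrow> q h < i \<longrightarrow> i < k \<longrightarrow> k \<le> q (Suc h) \<longrightarrow> f i < f k"
  show "carrel_increasing n lam f"
    unfolding carrel_increasing_def
  proof
    fix h assume "h \<in> {1..r + 1}"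
    then obtain g where g: "h = Suc g" "g \<le> r"
      by (cases h) auto
    show "strict_mono_on (carrel n lam h) f"
      unfolding g carrel_Suc using inc g(2) by (auto simp: strict_mono_on_def)
  qed
qed

text \<open>At a descent across \<open>q h\<close>, avoidance puts all numbers from
  \<open>?b\<close> to \<open>?m\<close> into the next key set. Exactly \<open>q h\<close> elements
  lie below \<open>?b\<close>, so these numbers have the consecutive ranks from
  \<open>q h + 1\<close> on, which is the required run of unit steps.\<close>

lemma Psi_in_UG:
  assumes \<pi>: "\<pi> \<in> S312_perms n lam"
  shows "Psi n lam \<pi> \<in> UG_tuples n lam"
proof -
  have perm: "\<pi> permutes {1..n}"
    using \<pi> permD S312D by blast
  let ?\<gamma> = "Psi n lam \<pi>"
  have card: "card (key_set \<pi> h) = q h" for h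
    using card_key_set[OF perm] .
  have bounds: "i \<le> ?\<gamma> i \<and> ?\<gamma> i \<in> {1..n}" if i: "i \<in> {1..n}" for i
  proof -
    obtain h where h: "h \<le> r" "q h < i" "i \<le> q (Suc h)"
      using carrel_ex[of i] i by auto
    have sub: "key_set \<pi> (Suc h) \<subseteq> {1..n}"
      using key_set_subset[OF perm] h by simp
    have "0 \<notin> key_set \<pi> (Suc h)"
      using sub by (meson atLeastAtMost_iff not_one_le_zero subsetD)
    then have "i \<le> kth (key_set \<pi> (Suc h)) i"
      using index_le_kth[of "key_set \<pi> (Suc h)" i] card i h by simp
    moreover have "kth (key_set \<pi> (Suc h)) i \<in> key_set \<pi> (Suc h)"
      using kth_in[of "key_set \<pi> (Suc h)" i] card i h by simp
    ultimately show ?thesis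
      using Psi_eq[OF perm h] sub by auto
  qed
  then have U: "?\<gamma> \<in> U_tuples n"
    unfolding U_tuples_def by (auto simp: Psi_def)
  have "?\<gamma> i < ?\<gamma> k" if "h \<le> r" "q h < i" "i < k" "k \<le> q (Suc h)" for h i k
    using Psi_eq[OF perm, of h i] Psi_eq[OF perm, of h k] that
      kth_strict[of "key_set \<pi> (Suc h)" i k] card[of "Suc h"] by simp
  then have UI: "?\<gamma> \<in> UI_tuples n lam"
    using U unfolding UI_tuples_def carrel_increasing_iff by blast
  have "s \<le> q (h + 1) - q h \<and> (\<forall>t\<in>{1..s}. ?\<gamma> (q h + t) = ?\<gamma> (q h) - s + t)"
    if h: "h \<in> {1..r}" and drop: "?\<gamma> (q h) > ?\<gamma> (q h + 1)"
      and s: "s = ?\<gamma> (q h) - ?\<gamma> (q h + 1) + 1" for h s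
  proof -
    let ?A = "key_set \<pi> h" and ?B = "key_set \<pi> (Suc h)"
    let ?m = "?\<gamma> (q h)" and ?b = "?\<gamma> (q h + 1)"
    obtain h' where h': "h = Suc h'" "h' \<le> r"
      using h by (cases h) auto
    have less: "q h' < q h" "q h < q (Suc h)"
      using q_strict[of h' h] q_strict[of h "Suc h"] h h' by auto
    have m: "?m = kth ?A (q h)"
      using Psi_eq[OF perm h'(2)] h' less by simp
    have b: "?b = kth ?B (q h + 1)"
      using Psi_eq[OF perm, of h "q h + 1"] h less by simp
    have mA: "?m \<in> ?A"
      unfolding m using kth_in[of ?A "q h"] card[of h] less by simp
    have bB: "?b \<in> ?B"
      unfolding b using kth_in[of ?B "q h + 1"] card[of "Suc h"] less by simp
    have below: "card {y \<in> ?B. y < ?b} = q h"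
      unfolding b using card_less_kth[of ?B "q h + 1"] card[of "Suc h"] less by simp
    \<comment> \<open>Pigeonhole: \<open>?B\<close> has \<open>q h + 1\<close> elements up to
      \<open>?b\<close>, one more than \<open>?A\<close> can hold.\<close>
    obtain b' where b': "b' \<in> ?B - ?A" "b' \<le> ?b"
    proof (rule ccontr)
      assume "\<not> thesis"
      then have "y \<in> ?A" if "y \<in> ?B" "y \<le> ?b" for y
        using \<open>\<And>b'. b' \<in> ?B - ?A \<Longrightarrow> b' \<le> ?b \<Longrightarrow> thesis\<close>[of y] that by (simp only: Diff_iff) blast
      then have "insert ?b {y \<in> ?B. y < ?b} \<subseteq> ?A"
        using bB by (simp only: insert_subset Collect_subset subset_iff mem_Collect_eq) simp
      then have "card (insert ?b {y \<in> ?B. y < ?b}) \<le> card ?A"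
        by (intro card_mono) auto
      then show False
        using below card[of h] by simp
    qed
    have int: "{?b..?m} \<subseteq> ?B"
    proof
      fix y assume "y \<in> {?b..?m}"
      then show "y \<in> ?B"
        using S312_step[OF \<pi> _ _ b'(1) mA, of y] h b'(2) by simp
    qed
    have count: "card ({y \<in> ?B. y < ?b} \<union> {?b..<y}) = q h + (y - ?b)" for y
      using below by (subst card_Un_disjoint) auto
    have "{y \<in> ?B. y < ?b} \<union> {?b..<Suc ?m} \<subseteq> ?B"
      using int by auto
    then have "card ({y \<in> ?B. y < ?b} \<union> {?b..<Suc ?m}) \<le> card ?B"
      by (intro card_mono) auto
    then have "q h + s \<le> q (Suc h)"
      using count[of "Suc ?m"] card[of "Suc h"] s drop by simp
    moreover have "?\<gamma> (q h + t) = ?m - s + t" if t: "t \<in> {1..s}" for t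
    proof -
      let ?y = "?b + (t - 1)"
      have y: "?y \<in> {?b..?m}"
        using t s drop by auto
      then have "{x \<in> ?B. x < ?y} = {x \<in> ?B. x < ?b} \<union> {?b..<?y}"
        using int by auto
      then have "card {x \<in> ?B. x < ?y} = q h + t - 1"
        using count[of ?y] t by simp
      then have "kth ?B (q h + t) = ?y"
        using y int t by (intro kth_eqI) auto
      moreover have "?\<gamma> (q h + t) = kth ?B (q h + t)"
        using Psi_eq[OF perm, of h "q h + t"] h t \<open>q h + s \<le> q (Suc h)\<close> by simp
      moreover have "1 \<le> ?b"
        using bB key_set_subset[OF perm, of "Suc h"] h by auto
      ultimately show ?thesis
        using s drop t by simp
    qed
    ultimately show ?thesis by auto
  qed
  then show ?thesis
    using UI unfolding UG_tuples_def Let_def by blast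
qed

subsection \<open>Cores\<close>

lemma candidate_iff:
  "y \<in> critical_candidates n lam \<upsilon> h x \<longleftrightarrow> q (h - 1) < y \<and> y < x \<and> \<upsilon> y + (x - y) < \<upsilon> x"
  unfolding critical_candidates_def by auto

lemma finite_candidates: "finite (critical_candidates n lam \<upsilon> h x)"
  by (rule finite_subset[of _ "{..<x}"]) (auto simp: candidate_iff)

lemma carrel_critical_bounds:
  assumes "x \<in> carrel_critical n lam \<upsilon> (Suc h)" "h \<le> r"
  shows "q h < x \<and> x \<le> q (Suc h)"
  using assms(1)
proof induction
  case carrel_end
  then show ?case
    using q_strict[of h "Suc h"] assms(2) by simp
next
  case (next_critical x)
  then show ?case
    using Max_in[OF finite_candidates next_critical(2)] by (auto simp: candidate_iff)
qed

text \<open>Allowing \<open>x = i\<close> merges the two cases of \<open>core\<close>: at a critical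
  index the correction \<open>x - i\<close> vanishes.\<close>

definition next_crit :: "(nat \<Rightarrow> nat) \<Rightarrow> nat \<Rightarrow> nat" where
  "next_crit \<upsilon> i = (LEAST x. x \<in> critical n lam \<upsilon> \<and> i \<le> x)"

text \<open>\<open>critical\<close> ranges over all carrels, but every carrel end is critical, so
  the least critical index from \<open>i\<close> on stays in the carrel of \<open>i\<close>.\<close>

lemma next_crit:
  assumes "h \<le> r" "q h < i" "i \<le> q (Suc h)"
  shows "i \<le> next_crit \<upsilon> i" "next_crit \<upsilon> i \<le> q (Suc h)" "next_crit \<upsilon> i \<in> carrel_critical n lam \<upsilon> (Suc h)"
    and "\<And>y. y \<in> carrel_critical n lam \<upsilon> (Suc h) \<Longrightarrow> i \<le> y \<Longrightarrow> next_crit \<upsilon> i \<le> y"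
proof -
  have crit: "y \<in> critical n lam \<upsilon>" if "y \<in> carrel_critical n lam \<upsilon> (Suc h)" for y
    using that assms(1) unfolding critical_def by auto
  have "q (Suc h) \<in> critical n lam \<upsilon> \<and> i \<le> q (Suc h)"
    using crit carrel_critical.carrel_end assms by blast
  then have least: "next_crit \<upsilon> i \<in> critical n lam \<upsilon> \<and> i \<le> next_crit \<upsilon> i"
      and "next_crit \<upsilon> i \<le> q (Suc h)"
    unfolding next_crit_def by - (rule LeastI, assumption, rule Least_le, assumption)
  then show "i \<le> next_crit \<upsilon> i" "next_crit \<upsilon> i \<le> q (Suc h)"
    by auto
  obtain h' where h': "h' \<in> {1..r + 1}" "next_crit \<upsilon> i \<in> carrel_critical n lam \<upsilon> h'"
    using least unfolding critical_def by blast
  then obtain g where g: "h' = Suc g" "g \<le> r"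
    by (cases h') auto
  have "q g < next_crit \<upsilon> i" "next_crit \<upsilon> i \<le> q (Suc g)"
    using carrel_critical_bounds[of "next_crit \<upsilon> i" \<upsilon> g] h' g by auto
  then have "carrel_index n lam (next_crit \<upsilon> i) = Suc g"
    using carrel_index_eq[OF g(2)] by blast
  moreover have "carrel_index n lam (next_crit \<upsilon> i) = Suc h"
    using carrel_index_eq[OF assms(1), of "next_crit \<upsilon> i"] assms(2) least
      \<open>next_crit \<upsilon> i \<le> q (Suc h)\<close> by simp
  ultimately have "Suc g = Suc h"
    by simp
  then show "next_crit \<upsilon> i \<in> carrel_critical n lam \<upsilon> (Suc h)"
    using h' g by simp
  show "next_crit \<upsilon> i \<le> y" if "y \<in> carrel_critical n lam \<upsilon> (Suc h)" "i \<le> y" for y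
    unfolding next_crit_def using that crit by (intro Least_le) auto
qed

lemma core_eq:
  assumes "i \<in> {1..n}"
  shows "core n lam \<upsilon> i = \<upsilon> (next_crit \<upsilon> i) - (next_crit \<upsilon> i - i)"
proof (cases "i \<in> critical n lam \<upsilon>")
  case True
  then have "next_crit \<upsilon> i = i"
    unfolding next_crit_def by (intro Least_equality) auto
  then show ?thesis
    using assms True by (simp add: core_def)
next
  case False
  then have "(LEAST x. x \<in> critical n lam \<upsilon> \<and> i < x) = next_crit \<upsilon> i"
    unfolding next_crit_def by (metis le_eq_less_or_eq)
  then show ?thesis
    using assms False by (simp add: core_def Let_def)
qed

text \<open>Otherwise \<open>i\<close> would be a candidate for the critical index
  \<open>?x\<close>, and the largest candidate would be a critical index at or after
  \<open>i\<close> but before \<open>?x\<close>.\<close>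

lemma next_crit_bound:
  assumes "h \<le> r" "q h < i" "i \<le> q (Suc h)"
  shows "\<upsilon> (next_crit \<upsilon> i) \<le> \<upsilon> i + (next_crit \<upsilon> i - i)"
proof (rule ccontr)
  let ?x = "next_crit \<upsilon> i"
  note nc = next_crit[where \<upsilon> = \<upsilon>, OF assms]
  assume gap: "\<not> ?thesis"
  then have "i \<noteq> ?x"
    by auto
  then have "i \<in> critical_candidates n lam \<upsilon> (Suc h) ?x"
    using gap nc(1) assms by (simp add: candidate_iff)
  then have "Max (critical_candidates n lam \<upsilon> (Suc h) ?x) \<in> carrel_critical n lam \<upsilon> (Suc h)"
      and le: "i \<le> Max (critical_candidates n lam \<upsilon> (Suc h) ?x)"
      and mem: "Max (critical_candidates n lam \<upsilon> (Suc h) ?x) \<in> critical_candidates n lam \<upsilon> (Suc h) ?x"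
    using nc(3) finite_candidates[of \<upsilon> "Suc h" ?x]
    by (auto intro!: carrel_critical.next_critical Max_ge Max_in)
  then show False
    using nc(4) by (auto simp: candidate_iff not_less[symmetric])
qed

lemma U_tuplesD:
  assumes "\<upsilon> \<in> U_tuples n" "i \<in> {1..n}"
  shows "i \<le> \<upsilon> i" "\<upsilon> i \<le> n"
  using assms unfolding U_tuples_def by (auto dest: PiE_mem)

text \<open>The core in row \<open>i\<close> is what the bound at the next critical index
  \<open>?x\<close> implies by strict increase down the column, which reaches row \<open>?x\<close>
  inside the same carrel. Conversely the core is pointwise at most \<open>\<eta>\<close>.\<close>

lemma row_bound_core:
  assumes \<eta>: "\<eta> \<in> U_tuples n"
  shows "row_bound_set n lam (core n lam \<eta>) = row_bound_set n lam \<eta>"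
proof -
  have "(\<forall>(j, i)\<in>bx. T (j, i) \<le> core n lam \<eta> i) \<longleftrightarrow> (\<forall>(j, i)\<in>bx. T (j, i) \<le> \<eta> i)"
    if T: "T \<in> tableaux n lam" for T
  proof (intro iffI ballI; clarify)
    fix j i assume box: "(j, i) \<in> bx"
    have i: "1 \<le> i" "i \<le> n"
      using box z_le_n[of j] by (auto simp: mem_boxes)
    obtain h where h: "h \<le> r" "q h < i" "i \<le> q (Suc h)"
      using carrel_ex[OF i] .
    let ?x = "next_crit \<eta> i"
    note nc = next_crit[where \<upsilon> = \<eta>, OF h]
    have core: "core n lam \<eta> i = \<eta> ?x - (?x - i)"
      using core_eq[of i] i by simp
    {
      assume "\<forall>(j, i)\<in>bx. T (j, i) \<le> core n lam \<eta> i"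
      then have "T (j, i) \<le> core n lam \<eta> i"
        using box by auto
      then show "T (j, i) \<le> \<eta> i"
        using core next_crit_bound[OF h, of \<eta>] by simp
    next
      assume le: "\<forall>(j, i)\<in>bx. T (j, i) \<le> \<eta> i"
      have "?x \<le> z j"
        using carrel_end_le_z[OF box h(1,2)] nc(2) by simp
      then have box': "(j, ?x) \<in> bx"
        using box nc(1) by (auto simp: mem_boxes)
      have "T (j, i) + (?x - i) \<le> T (j, ?x)"
        using tab_col[OF T box' i(1) nc(1)] .
      also have "\<dots> \<le> \<eta> ?x"
        using le box' by auto
      finally show "T (j, i) \<le> core n lam \<eta> i"
        using core by simp
    }
  qed
  then show ?thesis
    unfolding row_bound_set_def by auto
qed

text \<open>Up to a critical index the core grows in unit steps. To pass a critical index
  \<open>i\<close>, compare the excess \<open>\<upsilon> x - x\<close>: as \<open>i\<close> is the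
  largest candidate for some critical \<open>x\<close>, the next critical index \<open>?y\<close> is
  \<open>x\<close> or not a candidate, so its excess is at least that of \<open>x\<close>, which is
  larger than that of \<open>i\<close>.\<close>

lemma core_in_UI:
  assumes \<upsilon>: "\<upsilon> \<in> U_tuples n"
  shows "core n lam \<upsilon> \<in> UI_tuples n lam"
proof -
  let ?\<gamma> = "core n lam \<upsilon>"
  have ge: "next_crit \<upsilon> i \<le> \<upsilon> (next_crit \<upsilon> i) \<and> \<upsilon> (next_crit \<upsilon> i) \<le> n \<and> i \<le> next_crit \<upsilon> i"
    if i: "i \<in> {1..n}" for i
  proof -
    obtain h where h: "h \<le> r" "q h < i" "i \<le> q (Suc h)"
      using carrel_ex[of i] i by auto
    have "next_crit \<upsilon> i \<in> {1..n}"
      using next_crit(1,2)[where \<upsilon> = \<upsilon>, OF h] i q_le_n[of "Suc h"] h by auto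
    then show ?thesis
      using U_tuplesD[OF \<upsilon>] next_crit(1)[where \<upsilon> = \<upsilon>, OF h] by blast
  qed
  have "i \<le> ?\<gamma> i \<and> ?\<gamma> i \<le> n" if "i \<in> {1..n}" for i
    using ge[OF that] core_eq[OF that, of \<upsilon>] by linarith
  then have U: "?\<gamma> \<in> U_tuples n"
    unfolding U_tuples_def by (fastforce simp: core_def)
  have Suc_less: "?\<gamma> i < ?\<gamma> (Suc i)" if h: "h \<le> r" and i: "q h < i" "Suc i \<le> q (Suc h)" for h i
  proof -
    let ?x = "next_crit \<upsilon> i" and ?y = "next_crit \<upsilon> (Suc i)"
    have mem: "i \<in> {1..n}" "Suc i \<in> {1..n}"
      using i q_le_n[of "Suc h"] h by auto
    have nx: "i \<le> ?x" "?x \<in> carrel_critical n lam \<upsilon> (Suc h)"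
        "\<And>y. y \<in> carrel_critical n lam \<upsilon> (Suc h) \<Longrightarrow> i \<le> y \<Longrightarrow> ?x \<le> y"
      using next_crit[where i = "i" and \<upsilon> = \<upsilon>, OF h] i by auto
    have ny: "Suc i \<le> ?y" "?y \<in> carrel_critical n lam \<upsilon> (Suc h)"
        "\<And>y. y \<in> carrel_critical n lam \<upsilon> (Suc h) \<Longrightarrow> Suc i \<le> y \<Longrightarrow> ?y \<le> y"
      using next_crit[where i = "Suc i" and \<upsilon> = \<upsilon>, OF h] i by auto
    show ?thesis
    proof (cases "?x = i")
      case False
      then have "?y \<le> ?x"
        using ny(3)[OF nx(2)] nx(1) by simp
      moreover have "?x \<le> ?y"
        using nx(3)[OF ny(2)] ny(1) by simp
      ultimately have eq: "?y = ?x"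
        by simp
      show ?thesis
        using core_eq[OF mem(1), of \<upsilon>] core_eq[OF mem(2), of \<upsilon>] ge[OF mem(2)] mem(1)
        unfolding eq by linarith
    next
      case True
      then have "i \<in> carrel_critical n lam \<upsilon> (Suc h)"
        using nx(2) by simp
      then obtain x where x: "x \<in> carrel_critical n lam \<upsilon> (Suc h)"
          and cand: "critical_candidates n lam \<upsilon> (Suc h) x \<noteq> {}"
          and max: "i = Max (critical_candidates n lam \<upsilon> (Suc h) x)"
        using i by cases auto
      have "i \<in> critical_candidates n lam \<upsilon> (Suc h) x"
        using Max_in[OF finite_candidates cand] max by simp
      then have ix: "i < x" "\<upsilon> i + (x - i) < \<upsilon> x"
        by (auto simp: candidate_iff)
      have yx: "?y \<le> x"
        using ny(3)[OF x] ix by simp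
      have "\<upsilon> x \<le> \<upsilon> ?y + (x - ?y)"
      proof (cases "?y = x")
        case False
        have "?y \<notin> critical_candidates n lam \<upsilon> (Suc h) x"
          using Max_ge[OF finite_candidates, of ?y \<upsilon> "Suc h" x] max ny(1) by auto
        then show ?thesis
          using False yx ny(1) i by (auto simp: candidate_iff)
      qed simp
      then have "\<upsilon> i + (?y - i) < \<upsilon> ?y"
        using ix yx ny(1) by simp
      then show ?thesis
        using core_eq[OF mem(1), of \<upsilon>] core_eq[OF mem(2), of \<upsilon>] True ny(1) by simp
    qed
  qed
  have "?\<gamma> i < ?\<gamma> k" if "h \<le> r" "q h < i" "i < k" "k \<le> q (Suc h)" for h i k
  proof -
    have "Suc i \<le> k"
      using that by simp
    then show ?thesis
      using that(4)
    proof (induction rule: dec_induct)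
      case base
      then show ?case using Suc_less that by simp
    next
      case (step m)
      then show ?case
        using Suc_less[of h m] that by simp
    qed
  qed
  then show ?thesis
    using U unfolding UI_tuples_def carrel_increasing_iff by blast
qed

text \<open>Carrel ends are critical, so the core equals \<open>\<phi>\<close> at
  \<open>q h\<close>. By monotonicity \<open>\<phi>\<close> is at least that large at the first
  critical index \<open>?x\<close> of the next carrel, and up to \<open>?x\<close> the core climbs
  in unit steps; after a descent it therefore runs back to its value at \<open>q h\<close>.\<close>

lemma UF_subset_UGC: "UF_tuples n \<subseteq> UGC_tuples n lam"
proof
  fix \<phi> assume \<phi>: "\<phi> \<in> UF_tuples n"
  then have U: "\<phi> \<in> U_tuples n" and mono: "mono_on {1..n} \<phi>"
    by (auto simp: UF_tuples_def)
  let ?\<gamma> = "core n lam \<phi>"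
  have "s \<le> q (h + 1) - q h \<and> (\<forall>t\<in>{1..s}. ?\<gamma> (q h + t) = ?\<gamma> (q h) - s + t)"
    if h: "h \<in> {1..r}" and drop: "?\<gamma> (q h) > ?\<gamma> (q h + 1)"
      and s: "s = ?\<gamma> (q h) - ?\<gamma> (q h + 1) + 1" for h s
  proof -
    obtain h' where h': "h = Suc h'" "h' \<le> r"
      using h by (cases h) auto
    have less: "q h' < q h" "q h < q (Suc h)" "q (Suc h) \<le> n"
      using q_strict[of h' h] q_strict[of h "Suc h"] q_le_n[of "Suc h"] h h' by auto
    have "next_crit \<phi> (q h) = q h"
      using next_crit(1,2)[where i = "q h" and \<upsilon> = \<phi>, OF h'(2)] less h' by simp
    then have last: "?\<gamma> (q h) = \<phi> (q h)"
      using core_eq[of "q h" \<phi>] less by simp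
    let ?x = "next_crit \<phi> (q h + 1)"
    have nx: "q h + 1 \<le> ?x" "?x \<le> q (Suc h)" "?x \<in> carrel_critical n lam \<phi> (Suc h)"
        "\<And>y. y \<in> carrel_critical n lam \<phi> (Suc h) \<Longrightarrow> q h + 1 \<le> y \<Longrightarrow> ?x \<le> y"
      using next_crit[where h = h and i = "q h + 1" and \<upsilon> = \<phi>] less h by auto
    have val: "?\<gamma> (q h + t) = \<phi> ?x - (?x - (q h + t))" if t: "1 \<le> t" "q h + t \<le> ?x" for t
    proof -
      note nt = next_crit[where h = h and i = "q h + t" and \<upsilon> = \<phi>]
      have "next_crit \<phi> (q h + t) = ?x"
      proof (rule antisym)
        show "next_crit \<phi> (q h + t) \<le> ?x"
          using nt(4)[OF _ _ _ nx(3)] t h nx(2) by simp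
        show "?x \<le> next_crit \<phi> (q h + t)"
          using nx(4)[OF nt(3)] nt(1) t h nx(2) by simp
      qed
      then show ?thesis
        using core_eq[of "q h + t" \<phi>] t nx(2) less by simp
    qed
    have "\<phi> (q h) \<le> \<phi> ?x"
      using mono nx(1,2) less by (intro mono_onD[OF mono]) auto
    moreover have "?x \<le> \<phi> ?x"
      using U_tuplesD(1)[OF U, of ?x] nx less by simp
    moreover have first: "?\<gamma> (q h + 1) = \<phi> ?x - (?x - (q h + 1))"
      using val[of 1] nx by simp
    ultimately have sx: "q h + s \<le> ?x"
      using s last drop nx(1) by linarith
    have "?\<gamma> (q h + t) = ?\<gamma> (q h) - s + t" if "t \<in> {1..s}" for t
    proof -
      have t: "1 \<le> t" "t \<le> s" "q h + t \<le> ?x"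
        using that sx by auto
      then show ?thesis
        using val[OF t(1,3)] first s last drop \<open>?x \<le> \<phi> ?x\<close> nx(1) by linarith
    qed
    then show ?thesis
      using sx nx(2) by simp
  qed
  then have "?\<gamma> \<in> UG_tuples n lam"
    using core_in_UI[OF U] unfolding UG_tuples_def Let_def by blast
  then show "\<phi> \<in> UGC_tuples n lam"
    using U by (simp add: UGC_tuples_def)
qed

subsection \<open>Permutations from gapless tuples\<close>

lemma UG_tuplesD:
  assumes "\<gamma> \<in> UG_tuples n lam"
  shows "\<gamma> \<in> U_tuples n"
    and "\<And>h i k. h \<le> r \<Longrightarrow> q h < i \<Longrightarrow> i < k \<Longrightarrow> k \<le> q (Suc h) \<Longrightarrow> \<gamma> i < \<gamma> k"
    and "\<And>h. 1 \<le> h \<Longrightarrow> h \<le> r \<Longrightarrow> q h + overlap n lam \<gamma> h \<le> q (Suc h)"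
    and "\<And>h t. 1 \<le> h \<Longrightarrow> h \<le> r \<Longrightarrow> 1 \<le> t \<Longrightarrow> t \<le> overlap n lam \<gamma> h \<Longrightarrow>
      \<gamma> (q h + t) = \<gamma> (q h) - overlap n lam \<gamma> h + t"
proof -
  have UI: "\<gamma> \<in> UI_tuples n lam"
    using assms by (simp add: UG_tuples_def)
  then show U: "\<gamma> \<in> U_tuples n"
    by (simp add: UI_tuples_def)
  show "\<gamma> i < \<gamma> k" if "h \<le> r" "q h < i" "i < k" "k \<le> q (Suc h)" for h i k
    using UI that unfolding UI_tuples_def carrel_increasing_iff by blast
  have gap: "q h + overlap n lam \<gamma> h \<le> q (Suc h) \<and> (\<forall>t. 1 \<le> t \<longrightarrow> t \<le> overlap n lam \<gamma> h \<longrightarrow>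
      \<gamma> (q h + t) = \<gamma> (q h) - overlap n lam \<gamma> h + t)" if h: "1 \<le> h" "h \<le> r" for h
  proof -
    have less: "q h < q (Suc h)"
      using q_strict[of h "Suc h"] h by simp
    consider "\<gamma> (q h) < \<gamma> (q h + 1)" | "\<gamma> (q h) = \<gamma> (q h + 1)" | "\<gamma> (q h) > \<gamma> (q h + 1)"
      by linarith
    then show ?thesis
    proof cases
      case 1
      then show ?thesis
        using less by (simp add: overlap_def)
    next
      \<comment> \<open>The gapless condition speaks of strict descents only. Here the overlap is 1
        and the demand is the equality itself.\<close>
      case 2
      have "q h + 1 \<le> \<gamma> (q h + 1)"
        using U_tuplesD(1)[OF U, of "q h + 1"] less q_le_n[of "Suc h"] h by simp
      moreover have "overlap n lam \<gamma> h = 1"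
        using 2 by (simp add: overlap_def)
      ultimately show ?thesis
        using 2 less by (auto simp: le_antisym)
    next
      case 3
      then have "overlap n lam \<gamma> h = \<gamma> (q h) - \<gamma> (q h + 1) + 1"
        by (simp add: overlap_def)
      moreover have "h \<in> {1..r}"
        using h by simp
      moreover have "\<forall>h\<in>{1..r}. \<gamma> (q h) > \<gamma> (q h + 1) \<longrightarrow>
          \<gamma> (q h) - \<gamma> (q h + 1) + 1 \<le> q (h + 1) - q h \<and>
          (\<forall>t\<in>{1..\<gamma> (q h) - \<gamma> (q h + 1) + 1}.
            \<gamma> (q h + t) = \<gamma> (q h) - (\<gamma> (q h) - \<gamma> (q h + 1) + 1) + t)"
        using assms unfolding UG_tuples_def Let_def by blast
      ultimately have "overlap n lam \<gamma> h \<le> q (h + 1) - q h \<and>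
          (\<forall>t\<in>{1..overlap n lam \<gamma> h}. \<gamma> (q h + t) = \<gamma> (q h) - overlap n lam \<gamma> h + t)"
        using 3 by simp
      then show ?thesis
        using less by auto
    qed
  qed
  then show "q h + overlap n lam \<gamma> h \<le> q (Suc h)" if "1 \<le> h" "h \<le> r" for h
    using that by blast
  show "\<gamma> (q h + t) = \<gamma> (q h) - overlap n lam \<gamma> h + t"
    if "1 \<le> h" "h \<le> r" "1 \<le> t" "t \<le> overlap n lam \<gamma> h" for h t
    using gap that by blast
qed

lemma Pi_stage_stable:
  assumes "g \<le> h" "h \<le> r" "i \<le> q (Suc g)"
  shows "Pi_stage n lam \<gamma> h i = Pi_stage n lam \<gamma> g i"
  using assms
proof (induction rule: dec_induct)
  case (step m)
  have "q (Suc g) \<le> q (Suc m)"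
    using q_mono[of "Suc g" "Suc m"] step by simp
  then show ?case
    using step by (simp add: Let_def)
qed simp

context
  fixes \<gamma>
  assumes \<gamma>: "\<gamma> \<in> UG_tuples n lam"
begin

text \<open>Injectivity and the range bound are what the next stage consumes,
  \<open>\<gamma> (q (Suc h))\<close> becoming its \<open>m\<close>; the other parts are recorded to
  be read off stage by stage.\<close>

lemma Pi_stage_invariant:
  assumes "h \<le> r"
  shows "inj_on (Pi_stage n lam \<gamma> h) {1..q (Suc h)} \<and>
    Pi_stage n lam \<gamma> h ` {1..q (Suc h)} \<subseteq> {1..\<gamma> (q (Suc h))} \<and>
    (\<forall>i k. q h < i \<and> i < k \<and> k \<le> q (Suc h) \<longrightarrow> Pi_stage n lam \<gamma> h i < Pi_stage n lam \<gamma> h k) \<and>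
    (\<forall>i. q h < i \<and> i \<le> q (Suc h) \<longrightarrow> kth (Pi_stage n lam \<gamma> h ` {1..q (Suc h)}) i = \<gamma> i) \<and>
    (\<forall>b c y. 1 \<le> h \<and> b \<in> Pi_stage n lam \<gamma> h ` {1..q (Suc h)} - Pi_stage n lam \<gamma> h ` {1..q h} \<and>
      c \<in> Pi_stage n lam \<gamma> h ` {1..q h} \<and> b \<le> y \<and> y \<le> c \<longrightarrow> y \<in> Pi_stage n lam \<gamma> h ` {1..q (Suc h)})"
  using assms
proof (induction h)
  case 0
  have less: "0 < q (Suc 0)" "q (Suc 0) \<le> n"
    using q_strict[of 0 "Suc 0"] q_le_n[of "Suc 0"] by auto
  have incr: "\<gamma> i < \<gamma> k" if "0 < i" "i < k" "k \<le> q (Suc 0)" for i k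
    using UG_tuplesD(2)[OF \<gamma>, of 0 i k] that by simp
  have "i \<le> \<gamma> i" if "0 < i" "i \<le> q (Suc 0)" for i
    using U_tuplesD(1)[OF UG_tuplesD(1)[OF \<gamma>], of i] that less by simp
  note upper = this
  \<comment> \<open>The first carrel is an instance of the general step with \<open>a\<close>,
    \<open>m\<close> and \<open>s\<close> all 0.\<close>
  have s: "0 = (if \<gamma> (0 + 1) \<le> 0 then 0 - \<gamma> (0 + 1) + 1 else 0)"
    using upper[of 1] less by simp
  have "\<gamma> i = (if i \<le> 0 then \<gamma> i else if i \<le> 0 + 0
      then rank_desc (0 + 0 - i + 1) ({1..0} - \<gamma> ` {1..0}) else \<gamma> i)" for i
    by simp
  note step = Pi_step[OF less(1) _ _ incr upper s _ _ this]
  have "inj_on \<gamma> {1..q (Suc 0)}" "\<gamma> ` {1..q (Suc 0)} \<subseteq> {1..\<gamma> (q (Suc 0))}"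
      "\<And>i. 0 < i \<Longrightarrow> i \<le> q (Suc 0) \<Longrightarrow> kth (\<gamma> ` {1..q (Suc 0)}) i = \<gamma> i"
    using step(1,2,4) less by simp_all
  then show ?case
    using incr by simp
next
  case (Suc h)
  let ?\<rho> = "Pi_stage n lam \<gamma> h" and ?\<sigma> = "Pi_stage n lam \<gamma> (Suc h)"
  let ?a = "q (Suc h)" and ?e = "q (Suc (Suc h))" and ?s = "overlap n lam \<gamma> (Suc h)"
  have less: "?a < ?e" "?e \<le> n"
    using q_strict[of "Suc h" "Suc (Suc h)"] q_le_n[of "Suc (Suc h)"] Suc.prems by auto
  have incr: "\<gamma> i < \<gamma> k" if "?a < i" "i < k" "k \<le> ?e" for i k
    using UG_tuplesD(2)[OF \<gamma> Suc.prems] that by simp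
  have upper: "i \<le> \<gamma> i" if "?a < i" "i \<le> ?e" for i
    using U_tuplesD(1)[OF UG_tuplesD(1)[OF \<gamma>], of i] that less by simp
  have s: "?s = (if \<gamma> (?a + 1) \<le> \<gamma> ?a then \<gamma> ?a - \<gamma> (?a + 1) + 1 else 0)"
    by (simp add: overlap_def)
  have \<sigma>: "?\<sigma> i = (if i \<le> ?a then ?\<rho> i
      else if i \<le> ?a + ?s then rank_desc (?a + ?s - i + 1) ({1..\<gamma> ?a} - ?\<rho> ` {1..?a}) else \<gamma> i)" for i
    by (simp add: Let_def)
  have inj: "inj_on ?\<rho> {1..?a}" and sub: "?\<rho> ` {1..?a} \<subseteq> {1..\<gamma> ?a}"
    using Suc.IH Suc.prems by simp_all
  note gap = UG_tuplesD(3,4)[OF \<gamma> _ Suc.prems]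
  have gap1: "?a + ?s \<le> ?e"
    using gap(1) by simp
  have gap2: "\<gamma> (?a + t) = \<gamma> ?a - ?s + t" if "1 \<le> t" "t \<le> ?s" for t
    using gap(2) that by simp
  note step = Pi_step[OF less(1) inj sub incr upper s gap1 gap2 \<sigma>]
  show ?case
    by (intro conjI allI impI; (elim conjE)?; rule step; assumption)
qed

lemmas Pi_stage_inj = Pi_stage_invariant[THEN conjunct1]
lemmas Pi_stage_sub = Pi_stage_invariant[THEN conjunct2, THEN conjunct1]
lemmas Pi_stage_incr =
  Pi_stage_invariant[THEN conjunct2, THEN conjunct2, THEN conjunct1, rule_format, OF _ conjI, OF _ _ conjI]
lemmas Pi_stage_kth =
  Pi_stage_invariant[THEN conjunct2, THEN conjunct2, THEN conjunct2, THEN conjunct1, rule_format, OF _ conjI]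
lemmas Pi_stage_interval =
  Pi_stage_invariant[THEN conjunct2, THEN conjunct2, THEN conjunct2, THEN conjunct2, rule_format]

lemma Pi_map_eq_stage: "h \<le> r \<Longrightarrow> 1 \<le> i \<Longrightarrow> i \<le> q (Suc h) \<Longrightarrow> Pi_map n lam \<gamma> i = Pi_stage n lam \<gamma> h i"
  using Pi_stage_stable[of h r i \<gamma>] q_le_n[of "Suc h"] by (simp add: Pi_map_def)

lemma key_set_Pi_map: "h \<le> r \<Longrightarrow> g \<le> Suc h \<Longrightarrow> key_set (Pi_map n lam \<gamma>) g = Pi_stage n lam \<gamma> h ` {1..q g}"
  using Pi_map_eq_stage[of h] q_mono[of g "Suc h"] by (intro image_cong) auto

text \<open>Avoidance is the interval property of stage \<open>h\<close>, since later stages leave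
  the key sets up to \<open>Suc h\<close> unchanged.\<close>

lemma Pi_map_in_S312: "Pi_map n lam \<gamma> \<in> S312_perms n lam"
proof -
  let ?\<pi> = "Pi_map n lam \<gamma>"
  have eq: "?\<pi> ` {1..n} = Pi_stage n lam \<gamma> r ` {1..n}"
    using key_set_Pi_map[of r "Suc r"] by simp
  have "\<gamma> n \<le> n"
    using U_tuplesD(2)[OF UG_tuplesD(1)[OF \<gamma>], of n] n_pos by simp
  then have "{1..\<gamma> n} \<subseteq> {1..n}"
    by simp
  then have sub: "?\<pi> ` {1..n} \<subseteq> {1..n}"
    using Pi_stage_sub[of r] unfolding eq q_last by blast
  have inj: "inj_on ?\<pi> {1..n}"
    using Pi_stage_inj[of r] Pi_map_eq_stage[of r]
      inj_on_cong[of "{1..n}" ?\<pi> "Pi_stage n lam \<gamma> r"] by simp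
  have perm: "?\<pi> permutes {1..n}"
  proof (rule bij_imp_permutes)
    show "bij_betw ?\<pi> {1..n} {1..n}"
      using inj sub endo_inj_surj[of "{1..n}" ?\<pi>] by (simp add: bij_betw_def)
  qed (auto simp: Pi_map_def)
  have "?\<pi> i < ?\<pi> k" if "h \<le> r" "q h < i" "i < k" "k \<le> q (Suc h)" for h i k
    using Pi_stage_incr[OF that] Pi_map_eq_stage[OF that(1)] that by simp
  then have S: "?\<pi> \<in> S_perms n lam"
    using perm unfolding S_perms_def carrel_increasing_iff by blast
  have "y \<in> key_set ?\<pi> (Suc h)"
    if h: "1 \<le> h" "h \<le> r" and "b \<in> key_set ?\<pi> (Suc h) - key_set ?\<pi> h"
      "a \<in> key_set ?\<pi> h" "b < y" "y < a" for h a b y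
  proof -
    have keys: "key_set ?\<pi> h = Pi_stage n lam \<gamma> h ` {1..q h}"
        "key_set ?\<pi> (Suc h) = Pi_stage n lam \<gamma> h ` {1..q (Suc h)}"
      using key_set_Pi_map[OF h(2)] by auto
    show ?thesis
      using Pi_stage_interval[OF h(2), of b a y] that(3-6) h(1) unfolding keys by simp
  qed
  then have "\<not> contains_312 n lam ?\<pi>"
    unfolding contains_312_iff[OF perm] by blast
  then show ?thesis
    using S by (simp add: S312_perms_def)
qed

lemma Psi_Pi_map: "Psi n lam (Pi_map n lam \<gamma>) = \<gamma>"
proof
  fix i
  have perm: "Pi_map n lam \<gamma> permutes {1..n}"
    using Pi_map_in_S312 S312D permD by blast
  show "Psi n lam (Pi_map n lam \<gamma>) i = \<gamma> i"
  proof (cases "i \<in> {1..n}")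
    case True
    then obtain h where h: "h \<le> r" "q h < i" "i \<le> q (Suc h)"
      using carrel_ex[of i] by auto
    then show ?thesis
      using Psi_eq[OF perm h] key_set_Pi_map[OF h(1), of "Suc h"] Pi_stage_kth[OF h] by simp
  next
    case False
    \<comment> \<open>Outside \<open>{1..n}\<close> both sides are \<open>undefined\<close>.\<close>
    have "\<gamma> \<in> extensional {1..n}"
      using UG_tuplesD(1)[OF \<gamma>] by (auto simp: U_tuples_def PiE_def)
    then have "\<gamma> i = undefined"
      using False by (rule extensional_arb)
    then show ?thesis
      using False by (simp only: Psi_def restrict_apply if_False)
  qed
qed

text \<open>The maximum exceeds \<open>\<gamma>\<close> only inside an overlap, after a descent from
  \<open>\<gamma> (q h)\<close>. There \<open>\<gamma>\<close> climbs in unit steps back to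
  \<open>\<gamma> (q h)\<close>, so the bound at the end of the overlap already implies the smaller
  bounds \<open>\<gamma> i\<close> before it.\<close>

lemma running_max_UF:
  defines "\<phi> \<equiv> (\<lambda>i\<in>{1..n}. Max (\<gamma> ` {1..i}))"
  shows "\<phi> \<in> UF_tuples n" and "row_bound_set n lam \<phi> = row_bound_set n lam \<gamma>"
proof -
  note U = UG_tuplesD(1)[OF \<gamma>]
  have ge: "\<gamma> k \<le> \<phi> i" if "1 \<le> k" "k \<le> i" "i \<le> n" for i k
    using that by (auto simp: \<phi>_def)
  have le: "\<phi> i \<le> b" if "1 \<le> i" "i \<le> n" "\<And>k. 1 \<le> k \<Longrightarrow> k \<le> i \<Longrightarrow> \<gamma> k \<le> b" for i b
    using that by (auto simp: \<phi>_def)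
  have "i \<le> \<phi> i \<and> \<phi> i \<le> n" if "i \<in> {1..n}" for i
  proof
    show "i \<le> \<phi> i"
      using ge[of i i] U_tuplesD(1)[OF U that] that by simp
    show "\<phi> i \<le> n"
      using that U_tuplesD(2)[OF U] by (intro le) auto
  qed
  then have "\<phi> \<in> U_tuples n"
    unfolding U_tuples_def by (fastforce simp: \<phi>_def)
  moreover have "mono_on {1..n} \<phi>"
    using ge by (intro mono_onI le) auto
  ultimately show "\<phi> \<in> UF_tuples n"
    by (simp add: UF_tuples_def)
  \<comment> \<open>A nonempty overlap ends with the value \<open>\<gamma> (q h)\<close>, which the
    carrel end then dominates.\<close>
  have mono_q: "\<gamma> (q g) \<le> \<gamma> (q h)" if "1 \<le> g" "g \<le> h" "h \<le> Suc r" for g h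
    using that(2,3,1)
  proof (induction rule: dec_induct)
    case (step h)
    have less: "q h < q (Suc h)"
      using q_strict[of h "Suc h"] step by simp
    have mono: "\<gamma> i \<le> \<gamma> (q (Suc h))" if "q h < i" "i \<le> q (Suc h)" for i
      using UG_tuplesD(2)[OF \<gamma>, of h i "q (Suc h)"] step that by (cases "i = q (Suc h)") auto
    have h: "1 \<le> h" "h \<le> r"
      using step by auto
    have "\<gamma> (q h) \<le> \<gamma> (q (Suc h))"
    proof (cases "overlap n lam \<gamma> h = 0")
      case True
      then have "\<gamma> (q h) < \<gamma> (q h + 1)"
        by (auto simp: overlap_def split: if_splits)
      then show ?thesis
        using mono[of "q h + 1"] less by simp
    next
      case False
      let ?s = "overlap n lam \<gamma> h"
      have "\<gamma> (q h) \<le> \<gamma> (q h + ?s)"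
        using UG_tuplesD(4)[OF \<gamma> h, of ?s] False by simp
      also have "\<dots> \<le> \<gamma> (q (Suc h))"
        using mono[of "q h + ?s"] UG_tuplesD(3)[OF \<gamma> h] False by simp
      finally show ?thesis .
    qed
    then show ?case
      using step by simp
  qed simp
  have below: "\<gamma> k \<le> \<gamma> (q h)" if k: "1 \<le> k" "k \<le> q h" "h \<le> r" for k h
  proof -
    have "k \<le> n"
      using k q_le_n[of h] by simp
    then obtain g where g: "g \<le> r" "q g < k" "k \<le> q (Suc g)"
      using carrel_ex[OF k(1)] by blast
    have "q g < q h"
      using g k by simp
    then have "Suc g \<le> h"
      using q_less_imp[of g h] g by simp
    have "\<gamma> k \<le> \<gamma> (q (Suc g))"
      using UG_tuplesD(2)[OF \<gamma>, of g k "q (Suc g)"] g by (cases "k = q (Suc g)") auto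
    also have "\<dots> \<le> \<gamma> (q h)"
      using mono_q[of "Suc g" h] \<open>Suc g \<le> h\<close> k by simp
    finally show ?thesis .
  qed
  show "row_bound_set n lam \<phi> = row_bound_set n lam \<gamma>"
  proof (intro equalityI subsetI)
    fix T assume "T \<in> row_bound_set n lam \<gamma>"
    then have T: "T \<in> tableaux n lam" and bound: "\<And>j i. (j, i) \<in> bx \<Longrightarrow> T (j, i) \<le> \<gamma> i"
      by (auto simp: row_bound_set_def)
    have "T (j, i) \<le> \<phi> i" if "(j, i) \<in> bx" for j i
      using bound[OF that] ge[of i i] that z_le_n[of j] by (auto simp: mem_boxes)
    then show "T \<in> row_bound_set n lam \<phi>"
      using T by (auto simp: row_bound_set_def)
  next
    fix T assume "T \<in> row_bound_set n lam \<phi>"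
    then have T: "T \<in> tableaux n lam" and bound: "\<And>j i. (j, i) \<in> bx \<Longrightarrow> T (j, i) \<le> \<phi> i"
      by (auto simp: row_bound_set_def)
    have "T (j, i) \<le> \<gamma> i" if box: "(j, i) \<in> bx" for j i
    proof -
      have i: "1 \<le> i" "i \<le> n"
        using box z_le_n[of j] by (auto simp: mem_boxes)
      obtain h where h: "h \<le> r" "q h < i" "i \<le> q (Suc h)"
        using carrel_ex[OF i] .
      have max: "\<phi> k \<le> max (\<gamma> (q h)) (\<gamma> k)" if k: "q h < k" "k \<le> q (Suc h)" for k
      proof (rule le)
        fix l assume l: "1 \<le> l" "l \<le> k"
        show "\<gamma> l \<le> max (\<gamma> (q h)) (\<gamma> k)"
        proof (cases "l \<le> q h")
          case True
          then show ?thesis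
            using below[OF l(1) True h(1)] by simp
        next
          case False
          then show ?thesis
            using UG_tuplesD(2)[OF \<gamma> h(1), of l k] l k by (cases "l = k") auto
        qed
      qed (use k h q_le_n[of "Suc h"] in auto)
      show ?thesis
      \<comment> \<open>For \<open>h = 0\<close> the value \<open>\<gamma> (q h)\<close> is
        \<open>\<gamma> 0\<close>, which has no meaning; hence the condition
        \<open>1 \<le> h\<close>.\<close>
      proof (cases "1 \<le> h \<and> \<gamma> i < \<gamma> (q h)")
        case False
        have "\<phi> i \<le> \<gamma> i"
        proof (cases "1 \<le> h")
          case True
          then show ?thesis
            using max[OF h(2,3)] False by simp
        next
          case False
          then have h0: "q h = 0"
            by (cases h) auto
          show ?thesis
          proof (rule le[OF i])
            fix k assume "1 \<le> k" "k \<le> i"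
            then show "\<gamma> k \<le> \<gamma> i"
              using UG_tuplesD(2)[OF \<gamma> h(1), of k i] h h0 by (cases "k = i") auto
          qed
        qed
        then show ?thesis
          using bound[OF box] by simp
      next
        case True
        then have h1: "1 \<le> h" and drop: "\<gamma> i < \<gamma> (q h)"
          by auto
        let ?s = "overlap n lam \<gamma> h"
        note gap = UG_tuplesD(3,4)[OF \<gamma> h1 h(1)]
        have "\<gamma> (q h + 1) \<le> \<gamma> i"
          using UG_tuplesD(2)[OF \<gamma> h(1), of "q h + 1" i] h by (cases "i = q h + 1") auto
        then have s: "?s = \<gamma> (q h) - \<gamma> (q h + 1) + 1"
          using drop by (simp add: overlap_def)
        have "q h + 1 \<le> \<gamma> (q h + 1)"
          using U_tuplesD(1)[OF U, of "q h + 1"] h i by simp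
        then have sm: "?s \<le> \<gamma> (q h)"
          using s drop \<open>\<gamma> (q h + 1) \<le> \<gamma> i\<close> by linarith
        have end_s: "\<gamma> (q h + ?s) = \<gamma> (q h)"
          using gap(2)[of ?s] s sm by simp
        have i_less: "i < q h + ?s"
        proof (rule ccontr)
          assume "\<not> i < q h + ?s"
          then have "\<gamma> (q h + ?s) \<le> \<gamma> i"
            using UG_tuplesD(2)[OF \<gamma> h(1), of "q h + ?s" i] h s by (cases "i = q h + ?s") auto
          then show False
            using end_s drop by simp
        qed
        have box': "(j, q h + ?s) \<in> bx"
          using carrel_end_le_z[OF box h(1,2)] gap(1) box s by (auto simp: mem_boxes)
        \<comment> \<open>At the end of the overlap the maximum agrees with \<open>\<gamma>\<close>,
          so the bound there descends to row \<open>i\<close>.\<close>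
        have "T (j, i) + (q h + ?s - i) \<le> T (j, q h + ?s)"
          using tab_col[OF T box' i(1)] i_less by simp
        also have "\<dots> \<le> \<gamma> (q h)"
          using bound[OF box'] max[of "q h + ?s"] gap(1) s end_s by simp
        finally show ?thesis
          using gap(2)[of "i - q h"] h i_less sm by simp
      qed
    qed
    then show "T \<in> row_bound_set n lam \<gamma>"
      using T by (auto simp: row_bound_set_def)
  qed
qed

end

end

theorem theorem14p2:
  fixes n :: nat and lam :: "nat \<Rightarrow> nat"
  assumes "1 \<le> n" and "is_partition n lam"
  shows
    "(\<forall>\<eta>\<in>UGC_tuples n lam.
        Pi_map n lam (core n lam \<eta>) \<in> S312_perms n lam \<and>
        identical_gf (row_bound_sum n lam \<eta>)
          (demazure_poly n lam (Pi_map n lam (core n lam \<eta>)))) \<and>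
     (\<forall>\<pi>\<in>S312_perms n lam.
        Psi n lam \<pi> \<in> UG_tuples n lam \<and>
        identical_gf (demazure_poly n lam \<pi>) (row_bound_sum n lam (Psi n lam \<pi>))) \<and>
     (\<forall>\<phi>\<in>UF_tuples n. \<exists>!\<pi>. \<pi> \<in> S_perms n lam \<and>
        identical_gf (row_bound_sum n lam \<phi>) (demazure_poly n lam \<pi>)) \<and>
     (\<forall>\<pi>\<in>S312_perms n lam. \<exists>!f. f \<in> flag_schur_polys n lam \<and>
        identical_gf (demazure_poly n lam \<pi>) f)"
proof -
  interpret shape n lam
    using assms by unfold_locales
  have ident: "identical_gf (tableau_sum n lam X) (tableau_sum n lam Y) \<longleftrightarrow> X = Y" for X Y
    by (simp add: identical_gf_def tableau_sum_def)
  have i: "Pi_map n lam (core n lam \<eta>) \<in> S312_perms n lam"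
      "row_bound_set n lam \<eta> = demazure_set n lam (Pi_map n lam (core n lam \<eta>))"
    if \<eta>: "\<eta> \<in> UGC_tuples n lam" for \<eta>
  proof -
    have U: "\<eta> \<in> U_tuples n" and G: "core n lam \<eta> \<in> UG_tuples n lam"
      using \<eta> by (auto simp: UGC_tuples_def)
    show S: "Pi_map n lam (core n lam \<eta>) \<in> S312_perms n lam"
      using Pi_map_in_S312[OF G] .
    show "row_bound_set n lam \<eta> = demazure_set n lam (Pi_map n lam (core n lam \<eta>))"
      using demazure_eq_row_bound[OF S] Psi_Pi_map[OF G] row_bound_core[OF U] by simp
  qed
  have "\<exists>!\<pi>. \<pi> \<in> S_perms n lam \<and> row_bound_set n lam \<phi> = demazure_set n lam \<pi>"
    if "\<phi> \<in> UF_tuples n" for \<phi>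
  proof -
    have \<phi>: "\<phi> \<in> UGC_tuples n lam"
      using that UF_subset_UGC by blast
    \<comment> \<open>Existence comes from part (i); uniqueness ranges over all of
      \<open>S_perms\<close> and is the injectivity of Demazure sets.\<close>
    show ?thesis
      using i[OF \<phi>] S312D demazure_inj by (intro ex1I) auto
  qed
  moreover have "\<exists>!f. f \<in> flag_schur_polys n lam \<and> identical_gf (demazure_poly n lam \<pi>) f"
    if \<pi>: "\<pi> \<in> S312_perms n lam" for \<pi>
  proof -
    obtain \<phi> where \<phi>: "\<phi> \<in> UF_tuples n" "row_bound_set n lam \<phi> = demazure_set n lam \<pi>"
      using running_max_UF[OF Psi_in_UG[OF \<pi>]] demazure_eq_row_bound[OF \<pi>] by metis
    show ?thesis
    proof (rule ex1I)
      show "row_bound_sum n lam \<phi> \<in> flag_schur_polys n lam \<and>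
          identical_gf (demazure_poly n lam \<pi>) (row_bound_sum n lam \<phi>)"
      proof
        show "row_bound_sum n lam \<phi> \<in> flag_schur_polys n lam"
          unfolding flag_schur_polys_def using \<phi>(1) by (rule imageI)
        show "identical_gf (demazure_poly n lam \<pi>) (row_bound_sum n lam \<phi>)"
          using \<phi>(2) by (simp add: row_bound_sum_def demazure_poly_def ident)
      qed
      \<comment> \<open>Shape and tableau set determine the whole record, so \<open>f\<close> is
        unique even if several flags define it.\<close>
      show "f = row_bound_sum n lam \<phi>"
        if "f \<in> flag_schur_polys n lam \<and> identical_gf (demazure_poly n lam \<pi>) f" for f
        using that \<phi> by (auto simp: flag_schur_polys_def row_bound_sum_def demazure_poly_def ident)
    qed
  qed
  ultimately show ?thesis
    using i Psi_in_UG demazure_eq_row_bound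
    by (simp add: row_bound_sum_def demazure_poly_def ident)
qed

end
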